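(* For each $K>0$ there exists $C<\infty$ such that for every field $\alpha=(\alpha_x)_{x\in\mathbb{Z}^d}$ with $-K\le\alpha_x\le K$ for all $x$, every cube $\Lambda_L\subset\mathbb{Z}^d$ of side length $L$, every integer $0\le N\le L^d$ and every $f:\{0,1\}^{\Lambda_L}\to\mathbb{R}$, $$\mathrm{Var}_{\Lambda_L,N}(f)\le CL^2\,E_{\Lambda_L,N}\Big[\sum_{x,y\in\Lambda_L,\ |x-y|=1}(\nabla_{xy}f)^2\Big].$$
   Context: $E_{\Lambda,N}$ and $\mathrm{Var}_{\Lambda,N}$ denote expectation and variance with respect to the probability measure on $\{\eta\in\{0,1\}^{\Lambda}:\sum_{x\in\Lambda}\eta_x=N\}$ proportional to $\exp\{\sum_{x\in\Lambda}\alpha_x\eta_x\}$. $\nabla_{xy}f(\eta)=f(T_{xy}\eta)-f(\eta)$, where $T_{xy}\eta$ is the configuration $\eta$ with the values at $x$ and $y$ exchanged. *)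

theory Defs
  imports Complex_Main
begin

text \<open>Sites of Z^d are functions 'd \<Rightarrow> int for a finite index type 'd (so d = CARD('d)).
 Configurations are functions site \<Rightarrow> nat, valued in {0,1} on \<Lambda> and 0 outside.\<close>

type_synonym 'd site = "'d \<Rightarrow> int"
type_synonym 'd config = "'d site \<Rightarrow> nat"

definition cube :: "'d::finite site \<Rightarrow> nat \<Rightarrow> 'd site set" where
  "cube a L = {x. \<forall>i. a i \<le> x i \<and> x i < a i + int L}"

definition configs :: "'d site set \<Rightarrow> nat \<Rightarrow> 'd config set" where
  "configs \<Lambda> N = {\<eta>. (\<forall>x\<in>\<Lambda>. \<eta> x \<in> {0,1}) \<and> (\<forall>x. x \<notin> \<Lambda> \<longrightarrow> \<eta> x = 0)
                      \<and> (\<Sum>x\<in>\<Lambda>. \<eta> x) = N}"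

definition weight :: "('d site \<Rightarrow> real) \<Rightarrow> 'd site set \<Rightarrow> 'd config \<Rightarrow> real" where
  "weight \<alpha> \<Lambda> \<eta> = exp (\<Sum>x\<in>\<Lambda>. \<alpha> x * real (\<eta> x))"

definition Exp :: "('d site \<Rightarrow> real) \<Rightarrow> 'd site set \<Rightarrow> nat \<Rightarrow> ('d config \<Rightarrow> real) \<Rightarrow> real" where
  "Exp \<alpha> \<Lambda> N f = (\<Sum>\<eta>\<in>configs \<Lambda> N. weight \<alpha> \<Lambda> \<eta> * f \<eta>) / (\<Sum>\<eta>\<in>configs \<Lambda> N. weight \<alpha> \<Lambda> \<eta>)"

definition Var :: "('d site \<Rightarrow> real) \<Rightarrow> 'd site set \<Rightarrow> nat \<Rightarrow> ('d config \<Rightarrow> real) \<Rightarrow> real" where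
  "Var \<alpha> \<Lambda> N f = Exp \<alpha> \<Lambda> N (\<lambda>\<eta>. (f \<eta> - Exp \<alpha> \<Lambda> N f)\<^sup>2)"

definition swap_conf :: "'d site \<Rightarrow> 'd site \<Rightarrow> 'd config \<Rightarrow> 'd config" where
  "swap_conf x y \<eta> = \<eta>(x := \<eta> y, y := \<eta> x)"

definition grad :: "'d site \<Rightarrow> 'd site \<Rightarrow> ('d config \<Rightarrow> real) \<Rightarrow> 'd config \<Rightarrow> real" where
  "grad x y f \<eta> = f (swap_conf x y \<eta>) - f \<eta>"

definition adjacent :: "'d::finite site \<Rightarrow> 'd site \<Rightarrow> bool" where
  "adjacent x y \<longleftrightarrow> (\<Sum>i\<in>UNIV. (x i - y i)\<^sup>2) = 1"

end

theory Submission
  imports Defs "HOL-Analysis.Convex"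
begin

text \<open>
  Identify configurations with the sets of occupied sites and put \<open>l x = exp (\<alpha> x)\<close>, a number in
  \<open>[1/M, M]\<close> with \<open>M = exp K\<close>. For the mean-field dynamics in which a particle at \<open>x\<close> jumps to a hole
  \<open>y\<close> at rate \<open>l y\<close>, coupling shows that the Lipschitz seminorm contracts at rate at least
  \<open>card \<Lambda> / M\<close>, uniformly in the number of particles; since the dynamics is reversible, this bounds
  the variance by the energy of long-range swaps.

  A long-range swap is then compared with nearest-neighbour swaps along a path. With equal weights
  this is a triangle inequality without loss. In general, write each site weight as \<open>\<kappa> + (h - \<kappa>)\<close>
  with \<open>\<kappa> = 1/M\<close>: a site is `good' with the state-independent weight \<open>\<kappa>\<close>, or `bad' with the
  remaining weight, which is at most \<open>(1 - 1/M\<^sup>2) h\<close>. The lossless inequality applies along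
  the good sites, and a gap of \<open>g\<close> consecutive bad sites carries a factor \<open>(1 - 1/M\<^sup>2) ^ g\<close>,
  which beats the polynomial cost of crossing it by a direct path.
\<close>


section \<open>Energies of swaps\<close>

text \<open>The obstacle is the disorder. Passing a single site with unequal weights costs a
  constant factor, so a path treated site by site would cost a constant to the power of its length.
  Removing a state-independent part of each weight confines the loss to runs of bad sites.

  Energies are sums over all environments, with no restriction on the number of particles. The
  weights are then a product over sites and can be split one site at a time. The fixed number
  \<open>N\<close> returns at the end through a function that vanishes on sets of any other size.

  Origin of \<open>L ^ 2\<close>: the mean-field gap bounds \<open>card \<Lambda>\<close> times the
  variance by the swap energies of all pairs. Pairs are joined by paths parallel to the axes. A path
  costs its length, at most \<open>L\<close>, times the energies of its edges. For one direction, an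
  edge is met by at most \<open>L * card \<Lambda>\<close> pairs, since the start ranges over a line
  and the target over the cube. The total is of order \<open>L ^ 2 * card \<Lambda>\<close>, and the
  volume cancels.\<close>

definition two_state_energy ::
    "'v set \<Rightarrow> ('v \<Rightarrow> bool \<Rightarrow> real) \<Rightarrow> ('v set \<Rightarrow> real) \<Rightarrow> 'v \<Rightarrow> 'v \<Rightarrow> real" where
  "two_state_energy \<Lambda> h f x y =
     (\<Sum>S\<in>Pow (\<Lambda> - {x, y}). (\<Prod>z\<in>\<Lambda> - {x, y}. h z (z \<in> S)) * (f (insert x S) - f (insert y S))\<^sup>2)"

definition swap_energy ::
    "'v set \<Rightarrow> ('v \<Rightarrow> real) \<Rightarrow> ('v set \<Rightarrow> real) \<Rightarrow> 'v \<Rightarrow> 'v \<Rightarrow> real" where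
  "swap_energy \<Lambda> l f x y =
     (\<Sum>S\<in>Pow (\<Lambda> - {x, y}). prod l S * (f (insert x S) - f (insert y S))\<^sup>2)"

text \<open>The original weights are \<open>l z\<close> for an occupied and \<open>1\<close> for an
  empty site. Separate weights for both states are needed later because the good part is subtracted
  from both. The sites \<open>x\<close> and \<open>y\<close> carry no weight, so the energy is
  symmetric in them.\<close>

lemma two_state_energy_eq_swap_energy:
  assumes "finite \<Lambda>"
  shows "two_state_energy \<Lambda> (\<lambda>z s. if s then l z else 1) f x y = swap_energy \<Lambda> l f x y"
  unfolding two_state_energy_def swap_energy_def
proof (rule sum.cong[OF refl])
  fix S assume "S \<in> Pow (\<Lambda> - {x, y})"
  then have "(\<Lambda> - {x, y}) \<inter> {z. z \<in> S} = S" by auto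
  then have "(\<Prod>z\<in>\<Lambda> - {x, y}. if z \<in> S then l z else 1) = prod l S"
    using assms by (simp add: prod.If_cases)
  then show "(\<Prod>z\<in>\<Lambda> - {x, y}. if z \<in> S then l z else 1) * (f (insert x S) - f (insert y S))\<^sup>2
      = prod l S * (f (insert x S) - f (insert y S))\<^sup>2" by simp
qed

lemma swap_energy_commute: "swap_energy \<Lambda> l f x y = swap_energy \<Lambda> l f y x"
  by (simp add: swap_energy_def insert_commute power2_commute)

lemma swap_energy_nonneg:
  assumes "\<And>z. l z \<ge> 0"
  shows "swap_energy \<Lambda> l f x y \<ge> 0"
  unfolding swap_energy_def by (intro sum_nonneg mult_nonneg_nonneg prod_nonneg) (use assms in auto)

lemma two_state_energy_nonneg:
  assumes "\<And>z s. h z s \<ge> 0"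
  shows "two_state_energy \<Lambda> h f x y \<ge> 0"
  unfolding two_state_energy_def
  by (intro sum_nonneg mult_nonneg_nonneg prod_nonneg) (use assms in auto)

lemma two_state_energy_cong:
  assumes "\<And>z. z \<in> \<Lambda> - {x, y} \<Longrightarrow> h z = h' z"
  shows "two_state_energy \<Lambda> h f x y = two_state_energy \<Lambda> h' f x y"
  unfolding two_state_energy_def using assms by (intro sum.cong refl arg_cong2[of _ _ _ _ "(*)"] prod.cong) auto

lemma sum_Pow_insert:
  fixes g :: "'a set \<Rightarrow> 'b::comm_monoid_add"
  assumes "finite A" "z \<notin> A"
  shows "sum g (Pow (insert z A)) = (\<Sum>S\<in>Pow A. g S + g (insert z S))"
proof -
  have "inj_on (insert z) (Pow A)"
    using assms(2) by (auto simp: inj_on_def)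
  moreover have "Pow A \<inter> insert z ` Pow A = {}" using assms(2) by auto
  ultimately show ?thesis
    using assms by (simp add: Pow_insert sum.union_disjoint sum.reindex sum.distrib)
qed

text \<open>Brings the two states of one site \<open>z\<close> together under a common product, so
  that every change of \<open>h\<close> at \<open>z\<close> becomes a termwise comparison.\<close>

lemma two_state_energy_split:
  assumes "finite \<Lambda>" "z \<in> \<Lambda>" "z \<noteq> x" "z \<noteq> y"
  shows "two_state_energy \<Lambda> h f x y =
    (\<Sum>S\<in>Pow (\<Lambda> - {x, y, z}). (\<Prod>t\<in>\<Lambda> - {x, y, z}. h t (t \<in> S)) *
       (h z False * (f (insert x S) - f (insert y S))\<^sup>2 +
        h z True * (f (insert x (insert z S)) - f (insert y (insert z S)))\<^sup>2))"
proof -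
  let ?A = "\<Lambda> - {x, y, z}"
  have A: "\<Lambda> - {x, y} = insert z ?A" using assms by auto
  have "(\<Prod>t\<in>insert z ?A. h t (t \<in> S)) * F S
      + (\<Prod>t\<in>insert z ?A. h t (t \<in> insert z S)) * F (insert z S)
      = (\<Prod>t\<in>?A. h t (t \<in> S)) * (h z False * F S + h z True * F (insert z S))"
    if S: "S \<in> Pow ?A" for S and F :: "'a set \<Rightarrow> real"
  proof -
    have "(\<Prod>t\<in>?A. h t (t \<in> insert z S)) = (\<Prod>t\<in>?A. h t (t \<in> S))"
      by (rule prod.cong) auto
    moreover have "z \<notin> S" using S by auto
    ultimately show ?thesis using assms by (simp add: algebra_simps)
  qed
  note key = this
  show ?thesis
    unfolding two_state_energy_def A
    by (subst sum_Pow_insert) (use assms in \<open>simp, simp, intro sum.cong refl key\<close>)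
qed

text \<open>The energy is linear in the weight of a single site; this is what permits splitting
  \<open>z\<close> into a good and a bad version.\<close>

lemma two_state_energy_add:
  assumes "finite \<Lambda>" "z \<in> \<Lambda>" "z \<noteq> x" "z \<noteq> y" "\<And>s. h z s = a s + b s"
  shows "two_state_energy \<Lambda> h f x y =
    two_state_energy \<Lambda> (h(z := a)) f x y + two_state_energy \<Lambda> (h(z := b)) f x y"
proof -
  have "(\<Prod>t\<in>\<Lambda> - {x, y, z}. (h(z := c)) t (t \<in> S)) = (\<Prod>t\<in>\<Lambda> - {x, y, z}. h t (t \<in> S))" for c S
    by (rule prod.cong) auto
  then show ?thesis
    using assms by (simp add: two_state_energy_split sum.distrib[symmetric] algebra_simps)
qed

lemma two_state_energy_mono_scale:
  assumes "finite \<Lambda>" "z \<in> \<Lambda>" "z \<noteq> x" "z \<noteq> y"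
    and "\<And>t s. h t s \<ge> 0" "\<And>s. a s \<le> c * h z s"
  shows "two_state_energy \<Lambda> (h(z := a)) f x y \<le> c * two_state_energy \<Lambda> h f x y"
proof -
  have *: "(\<Prod>t\<in>\<Lambda> - {x, y, z}. (h(z := c)) t (t \<in> S)) = (\<Prod>t\<in>\<Lambda> - {x, y, z}. h t (t \<in> S))" for c S
    by (rule prod.cong) auto
  have "(\<Prod>t\<in>\<Lambda> - {x, y, z}. h t (t \<in> S)) * (a False * X + a True * Y)
      \<le> c * ((\<Prod>t\<in>\<Lambda> - {x, y, z}. h t (t \<in> S)) * (h z False * X + h z True * Y))"
    if "X \<ge> 0" "Y \<ge> 0" for X Y S
  proof -
    have "a False * X + a True * Y \<le> c * (h z False * X + h z True * Y)"
      using mult_right_mono[OF assms(6)[of False] that(1)] mult_right_mono[OF assms(6)[of True] that(2)]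
      by (simp add: algebra_simps)
    moreover have "(\<Prod>t\<in>\<Lambda> - {x, y, z}. h t (t \<in> S)) \<ge> 0"
      using assms(5) by (simp add: prod_nonneg)
    ultimately show ?thesis
      by (metis mult.left_commute mult_left_mono)
  qed
  then show ?thesis
    using assms(1-4) by (simp add: two_state_energy_split * sum_distrib_left sum_mono)
qed

lemma two_state_energy_scale:
  assumes "finite \<Lambda>" "z \<in> \<Lambda>" "z \<noteq> x" "z \<noteq> y" "\<And>s. h z s = c * a s"
  shows "two_state_energy \<Lambda> h f x y = c * two_state_energy \<Lambda> (h(z := a)) f x y"
proof -
  have *: "(\<Prod>t\<in>\<Lambda> - {x, y, z}. (h(z := c)) t (t \<in> S)) = (\<Prod>t\<in>\<Lambda> - {x, y, z}. h t (t \<in> S))" for c S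
    by (rule prod.cong) auto
  show ?thesis
    using assms by (simp add: two_state_energy_split * sum_distrib_left algebra_simps)
qed

section \<open>Triangle inequality for swap energies and its expansion along a path\<close>

lemma power2_diff_le_weighted:
  fixes a b c r s :: real
  assumes "r > 0" "s > 0"
  shows "(a - c)\<^sup>2 \<le> (r + s) * ((a - b)\<^sup>2 / r + (b - c)\<^sup>2 / s)"
proof -
  have "(r + s) * ((a - b)\<^sup>2 / r + (b - c)\<^sup>2 / s) - (a - c)\<^sup>2 = (s * (a - b) - r * (b - c))\<^sup>2 / (r * s)"
    using assms by (simp add: field_simps power2_eq_square)
  also have "\<dots> \<ge> 0" using assms by simp
  finally show ?thesis by simp
qed

text \<open>If \<open>m\<close> is empty the particle goes \<open>x \<rightarrow> m \<rightarrow> y\<close>; if it is occupied, first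
  \<open>m \<rightarrow> y\<close> and then \<open>x \<rightarrow> m\<close>. With both states of the third site equally weighted, each swap
  on the right-hand side is used exactly once.\<close>

lemma two_state_energy_triangle:
  assumes "finite \<Lambda>" "x \<in> \<Lambda>" "y \<in> \<Lambda>" "m \<in> \<Lambda>" "x \<noteq> y" "x \<noteq> m" "y \<noteq> m"
    and "\<And>t s. h t s \<ge> 0" and "r > 0" "q > 0"
  shows "two_state_energy \<Lambda> (h(m := \<lambda>_. 1)) f x y \<le>
    (r + q) * (two_state_energy \<Lambda> (h(y := \<lambda>_. 1)) f x m / r
             + two_state_energy \<Lambda> (h(x := \<lambda>_. 1)) f m y / q)"
proof -
  let ?A = "\<Lambda> - {x, y, m}"
  define W where "W S = (\<Prod>t\<in>?A. h t (t \<in> S))" for S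
  have "W S \<ge> 0" for S unfolding W_def using assms by (simp add: prod_nonneg)
  have A1: "\<Lambda> - {x, m, y} = ?A" "\<Lambda> - {m, y, x} = ?A" by auto
  have 1: "two_state_energy \<Lambda> (h(m := \<lambda>_. 1)) f x y = (\<Sum>S\<in>Pow ?A. W S * (
      (f (insert x S) - f (insert y S))\<^sup>2 + (f (insert x (insert m S)) - f (insert y (insert m S)))\<^sup>2))"
    by (subst two_state_energy_split[where z = m]) (use assms in \<open>auto simp: W_def\<close>)
  have 2: "two_state_energy \<Lambda> (h(y := \<lambda>_. 1)) f x m = (\<Sum>S\<in>Pow ?A. W S * (
      (f (insert x S) - f (insert m S))\<^sup>2 + (f (insert x (insert y S)) - f (insert m (insert y S)))\<^sup>2))"
    by (subst two_state_energy_split[where z = y]) (use assms A1 in \<open>auto simp: W_def\<close>)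
  have 3: "two_state_energy \<Lambda> (h(x := \<lambda>_. 1)) f m y = (\<Sum>S\<in>Pow ?A. W S * (
      (f (insert m S) - f (insert y S))\<^sup>2 + (f (insert m (insert x S)) - f (insert y (insert x S)))\<^sup>2))"
    by (subst two_state_energy_split[where z = x]) (use assms A1 in \<open>auto simp: W_def\<close>)
  have "W S * ((f (insert x S) - f (insert y S))\<^sup>2 + (f (insert x (insert m S)) - f (insert y (insert m S)))\<^sup>2)
     \<le> (r + q) * (W S * ((f (insert x S) - f (insert m S))\<^sup>2 + (f (insert x (insert y S)) - f (insert m (insert y S)))\<^sup>2) / r
       + W S * ((f (insert m S) - f (insert y S))\<^sup>2 + (f (insert m (insert x S)) - f (insert y (insert x S)))\<^sup>2) / q)" for S
  proof -
    \<comment> \<open>With \<open>m\<close> occupied the two moves come in the opposite order, so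
      \<open>r\<close> and \<open>q\<close> change places in the second use of the weighted
      inequality.\<close>
    have "(f (insert x S) - f (insert y S))\<^sup>2 + (f (insert x (insert m S)) - f (insert y (insert m S)))\<^sup>2
     \<le> (r + q) * (((f (insert x S) - f (insert m S))\<^sup>2 + (f (insert x (insert y S)) - f (insert m (insert y S)))\<^sup>2) / r
       + ((f (insert m S) - f (insert y S))\<^sup>2 + (f (insert m (insert x S)) - f (insert y (insert x S)))\<^sup>2) / q)"
      using power2_diff_le_weighted[OF assms(9,10), of "f (insert x S)" "f (insert y S)" "f (insert m S)"]
        power2_diff_le_weighted[OF assms(10,9), of "f (insert x (insert m S))" "f (insert y (insert m S))" "f (insert x (insert y S))"]
      by (simp add: insert_commute algebra_simps add_divide_distrib)
    from mult_left_mono[OF this \<open>W S \<ge> 0\<close>] show ?thesis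
      by (simp add: algebra_simps)
  qed
  then have "(\<Sum>S\<in>Pow ?A. W S * ((f (insert x S) - f (insert y S))\<^sup>2 + (f (insert x (insert m S)) - f (insert y (insert m S)))\<^sup>2))
    \<le> (\<Sum>S\<in>Pow ?A. (r + q) * (W S * ((f (insert x S) - f (insert m S))\<^sup>2 + (f (insert x (insert y S)) - f (insert m (insert y S)))\<^sup>2) / r
       + W S * ((f (insert m S) - f (insert y S))\<^sup>2 + (f (insert m (insert x S)) - f (insert y (insert x S)))\<^sup>2) / q))"
    by (rule sum_mono)
  then show ?thesis
    unfolding 1 2 3 by (simp only: sum_distrib_left[symmetric] sum.distrib sum_divide_distrib[symmetric])
qed

text \<open>In the first sum \<open>v\<close> is the first good site after \<open>u\<close>, in the second \<open>w < v\<close> are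
  consecutive good sites; in the induction step the site \<open>i\<close> is declared bad or good. The factor
  \<open>1 / (v - w)\<close> is the weight of the segment in the Cauchy--Schwarz inequality.\<close>

lemma two_state_energy_path_expansion:
  fixes f :: "'v set \<Rightarrow> real" and p :: "nat \<Rightarrow> 'v" and h :: "'v \<Rightarrow> bool \<Rightarrow> real"
  assumes fin: "finite \<Lambda>" and inj: "inj_on p {..n}" and sub: "p ` {..n} \<subseteq> \<Lambda>"
    and k: "0 \<le> k" "k \<le> 1" and t: "0 \<le> t"
    and "i \<le> n" "u < i" "\<And>z s. 0 \<le> h z s"
    and "\<And>j s. i \<le> j \<Longrightarrow> j < n \<Longrightarrow> k \<le> h (p j) s \<and> h (p j) s - k \<le> t * h (p j) s"
  defines "E \<equiv> \<lambda>h u v. two_state_energy \<Lambda> h f (p u) (p v)"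
  shows "E h u n \<le> real (n - u) *
    ((\<Sum>v = i..n. t ^ (v - i) * E (h(p u := \<lambda>_. 1, p n := \<lambda>_. 1)) u v / real (v - u))
   + (\<Sum>w = i..<n. \<Sum>v = Suc w..n. t ^ (v - Suc w) * E (h(p u := \<lambda>_. 1, p n := \<lambda>_. 1)) w v / real (v - w)))"
  using assms(7-10)
proof (induction i arbitrary: u h rule: inc_induct)
  \<comment> \<open>At \<open>i = n\<close> the double sum is empty and the first sum is its term
    \<open>v = n\<close>, in which \<open>t ^ 0 = 1\<close> and the factor \<open>n - u\<close>
    cancels.\<close>
  case base
  define h' where "h' = h(p u := \<lambda>_. 1, p n := \<lambda>_. 1)"
  have "E h u n = E h' u n"
    unfolding E_def h'_def by (rule two_state_energy_cong) auto
  then show ?case using base unfolding h'_def[symmetric] by simp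
next
  case (step i)
  note bounds = step.prems(2,3)
  have pe: "p a = p b \<longleftrightarrow> a = b" if "a \<le> n" "b \<le> n" for a b
    using inj that by (auto simp: inj_on_def)
  have pL: "p a \<in> \<Lambda>" if "a \<le> n" for a using sub that by auto
  define z where "z = p i"
  define one :: "bool \<Rightarrow> real" where "one = (\<lambda>_. 1)"
  \<comment> \<open>\<open>hb\<close> keeps the bad part of the weight at \<open>z\<close>;
    \<open>h2\<close> puts \<open>1\<close> there, the good weight \<open>k\<close> standing outside
    as a factor. Primed weights are flattened at both ends of the path.\<close>
  define hb where "hb = h(z := \<lambda>s. h z s - k)"
  define h' where "h' = h(p u := one, p n := one)"
  define hb' where "hb' = hb(p u := one, p n := one)"
  define h2 where "h2 = h(p u := one, p i := one, p n := one)"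
  define D where "D = real (n - u)"
  have D: "D = real (i - u) + real (n - i)" "D > 0"
    using step.hyps step.prems(1) by (auto simp: D_def)
  have zz: "z \<in> \<Lambda>" "z \<noteq> p u" "z \<noteq> p n" "p u \<noteq> p n"
    using pe[of i u] pe[of i n] pe[of u n] pL step.hyps step.prems(1) by (auto simp: z_def)
  have h'0: "h' t s \<ge> 0" for t s using bounds(1) by (auto simp: h'_def one_def)
  have kb: "k \<le> h z s" "h z s - k \<le> t * h z s" for s
    using bounds(2)[of i s] step.hyps by (auto simp: z_def)
  have split: "E h u n = E hb u n + k * E (h(z := one)) u n"
  proof -
    have "E h u n = E hb u n + E (h(z := \<lambda>_. k)) u n"
      unfolding E_def hb_def by (rule two_state_energy_add) (use fin zz in auto)
    moreover have "E (h(z := \<lambda>_. k)) u n = k * E (h(z := one)) u n"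
      unfolding E_def by (subst two_state_energy_scale[where z = z and c = k and a = one])
        (use fin zz in \<open>auto simp: one_def\<close>)
    ultimately show ?thesis by simp
  qed
  have bad: "E hb u n \<le> D * ((\<Sum>v = Suc i..n. t ^ (v - Suc i) * E hb' u v / real (v - u))
     + (\<Sum>w = Suc i..<n. \<Sum>v = Suc w..n. t ^ (v - Suc w) * E hb' w v / real (v - w)))"
    unfolding D_def hb'_def one_def
  proof (rule step.IH)
    show "u < Suc i" using step.prems(1) by simp
    show "0 \<le> hb z s" for z s using bounds(1) kb by (auto simp: hb_def)
    show "k \<le> hb (p j) s \<and> hb (p j) s - k \<le> t * hb (p j) s" if "Suc i \<le> j" "j < n" for j s
      using bounds(2)[of j s] that pe[of i j] by (auto simp: hb_def z_def)
  qed
  \<comment> \<open>A good \<open>z\<close> becomes a stop. Weighting the two legs by their lengths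
    \<open>i - u\<close> and \<open>n - i\<close> makes the prefactor exactly \<open>D\<close>; the
    second leg is then expanded by the induction hypothesis restarted at \<open>i\<close>.\<close>
  have good: "E (h(z := one)) u n \<le> D * (E (h(p n := one)) u i / real (i - u) + E (h(p u := one)) i n / real (n - i))"
    unfolding E_def D(1) z_def[symmetric] one_def
    by (rule two_state_energy_triangle) (use fin zz pL bounds(1) step.hyps step.prems(1) in auto)
  have good2: "E (h(p u := one)) i n \<le> real (n - i) *
       ((\<Sum>v = Suc i..n. t ^ (v - Suc i) * E h2 i v / real (v - i))
     + (\<Sum>w = Suc i..<n. \<Sum>v = Suc w..n. t ^ (v - Suc w) * E h2 w v / real (v - w)))"
    unfolding h2_def one_def
  proof (rule step.IH)
    show "i < Suc i" by simp
    show "0 \<le> (h(p u := \<lambda>_. 1)) z s" for z s using bounds(1) by auto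
    show "k \<le> (h(p u := \<lambda>_. 1)) (p j) s \<and> (h(p u := \<lambda>_. 1)) (p j) s - k \<le> t * (h(p u := \<lambda>_. 1)) (p j) s"
      if "Suc i \<le> j" "j < n" for j s
      using bounds(2)[of j s] that pe[of u j] step.prems(1) by auto
  qed
  have e1: "E (h(p n := one)) u i = E h' u i"
    unfolding E_def h'_def by (rule two_state_energy_cong) auto
  have e2: "E h2 i v = E h' i v" for v
    unfolding E_def h'_def h2_def by (rule two_state_energy_cong) auto
  \<comment> \<open>A pair starting at \<open>u\<close> and ending beyond \<open>z\<close> skips the
    bad site \<open>z\<close>. This is the source of the factor \<open>t\<close> per bad
    site.\<close>
  have e3: "E hb' u v \<le> t * E h' u v" if "Suc i \<le> v" "v \<le> n" for v
  proof -
    have "hb' = h'(z := \<lambda>s. h z s - k)"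
      unfolding hb'_def h'_def hb_def using zz by (simp add: fun_upd_twist)
    moreover have "h' z = h z" using zz by (simp add: h'_def)
    moreover have "z \<noteq> p v" using pe[of i v] that step.hyps by (simp add: z_def)
    ultimately show ?thesis
      unfolding E_def
      using two_state_energy_mono_scale[where h = h' and z = z and x = "p u" and y = "p v"
          and a = "\<lambda>s. h z s - k" and c = t and f = f and \<Lambda> = \<Lambda>] fin zz h'0 kb
      by simp
  qed
  \<comment> \<open>For pairs lying beyond \<open>z\<close> the two versions add up to the unsplit
    weight again, so nothing is lost however many sites are split.\<close>
  have e4: "E hb' w v + k * E h2 w v = E h' w v" if "Suc i \<le> w" "w \<le> n" "Suc i \<le> v" "v \<le> n" for w v
  proof -
    have nz: "z \<noteq> p v" "z \<noteq> p w" using pe[of i v] pe[of i w] that step.hyps by (auto simp: z_def)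
    have h'z: "h' z = h z" using zz by (simp add: h'_def)
    have "E h' w v = E (h'(z := \<lambda>s. h z s - k)) w v + E (h'(z := \<lambda>_. k)) w v"
      unfolding E_def by (rule two_state_energy_add) (use fin zz nz h'z in auto)
    also have "h'(z := \<lambda>s. h z s - k) = hb'"
      unfolding hb'_def h'_def hb_def using zz by (simp add: fun_upd_twist)
    also have "E (h'(z := \<lambda>_. k)) w v = k * E (h'(z := one)) w v"
      unfolding E_def by (subst two_state_energy_scale[where z = z and c = k and a = one])
        (use fin zz nz in \<open>auto simp: one_def\<close>)
    also have "h'(z := one) = h2"
      unfolding h'_def h2_def z_def[symmetric] using zz by (simp add: fun_upd_twist)
    finally show ?thesis by simp
  qed
  have E0: "E h' w v \<ge> 0" for w v unfolding E_def by (rule two_state_energy_nonneg[OF h'0])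
  define SA where "SA = (\<Sum>v = Suc i..n. t ^ (v - i) * E h' u v / real (v - u))"
  define SB where "SB = (\<Sum>v = Suc i..n. t ^ (v - Suc i) * E h' i v / real (v - i))"
  define SC where "SC = (\<Sum>w = Suc i..<n. \<Sum>v = Suc w..n. t ^ (v - Suc w) * E h' w v / real (v - w))"
  define SC1 where "SC1 = (\<Sum>w = Suc i..<n. \<Sum>v = Suc w..n. t ^ (v - Suc w) * E hb' w v / real (v - w))"
  define SC2 where "SC2 = (\<Sum>w = Suc i..<n. \<Sum>v = Suc w..n. t ^ (v - Suc w) * E h2 w v / real (v - w))"
  have SA: "(\<Sum>v = Suc i..n. t ^ (v - Suc i) * E hb' u v / real (v - u)) \<le> SA"
    unfolding SA_def
  proof (rule sum_mono)
    fix v assume v: "v \<in> {Suc i..n}"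
    then have "v - i = Suc (v - Suc i)" by auto
    then have "t ^ (v - i) * E h' u v = t ^ (v - Suc i) * (t * E h' u v)"
      by (simp only: power_Suc mult_ac)
    moreover have "t ^ (v - Suc i) * E hb' u v \<le> t ^ (v - Suc i) * (t * E h' u v)"
      using e3 v t by (intro mult_left_mono) auto
    ultimately show "t ^ (v - Suc i) * E hb' u v / real (v - u) \<le> t ^ (v - i) * E h' u v / real (v - u)"
      by (simp only: divide_right_mono of_nat_0_le_iff)
  qed
  have SC: "SC1 + k * SC2 = SC"
    unfolding SC_def SC1_def SC2_def sum_distrib_left sum.distrib[symmetric]
  proof (intro sum.cong refl)
    fix w v assume "w \<in> {Suc i..<n}" "v \<in> {Suc w..n}"
    then have "E h' w v = E hb' w v + k * E h2 w v" using e4[of w v] by auto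
    then show "t ^ (v - Suc w) * E hb' w v / real (v - w) + k * (t ^ (v - Suc w) * E h2 w v / real (v - w))
       = t ^ (v - Suc w) * E h' w v / real (v - w)"
      by (simp add: algebra_simps add_divide_distrib)
  qed
  have SB0: "SB \<ge> 0" unfolding SB_def by (intro sum_nonneg) (use E0 t in auto)
  have T0: "E h' u i / real (i - u) \<ge> 0" using E0 by simp
  have "E (h(p u := one)) i n / real (n - i) \<le> SB + SC2"
    using good2 step.hyps unfolding SB_def SC2_def e2 by (simp add: divide_le_eq mult.commute)
  then have "E (h(z := one)) u n \<le> D * (E h' u i / real (i - u) + (SB + SC2))"
    using good D(2) unfolding e1 by (meson add_left_mono mult_left_mono less_imp_le order_trans)
  from mult_left_mono[OF this k(1)]
  have "k * E (h(z := one)) u n \<le> D * (k * (E h' u i / real (i - u)) + k * SB + k * SC2)"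
    by (simp add: algebra_simps)
  \<comment> \<open>\<open>k \<le> 1\<close> removes the factor from the terms having
    \<open>p i\<close> as an endpoint; in \<open>SC2\<close> it is kept, to recombine with
    \<open>SC1\<close>.\<close>
  also have "\<dots> \<le> D * (E h' u i / real (i - u) + SB + k * SC2)"
    using D(2) mult_right_mono[OF k(2) T0] mult_right_mono[OF k(2) SB0]
    by (intro mult_left_mono) auto
  finally have G: "k * E (h(z := one)) u n \<le> D * (E h' u i / real (i - u) + SB + k * SC2)" .
  have "E hb u n \<le> D * (SA + SC1)"
    using bad SA D(2) unfolding SC1_def[symmetric] by (meson add_right_mono mult_left_mono less_imp_le order_trans)
  with G split have "E h u n \<le> D * (SA + SC1) + D * (E h' u i / real (i - u) + SB + k * SC2)" by simp
  also have "\<dots> = D * ((E h' u i / real (i - u) + SA) + (SB + SC))"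
    unfolding SC[symmetric] by (simp add: algebra_simps)
  also have "E h' u i / real (i - u) + SA = (\<Sum>v = i..n. t ^ (v - i) * E h' u v / real (v - u))"
    unfolding SA_def using step.hyps by (subst (2) sum.atLeast_Suc_atMost) auto
  also have "SB + SC = (\<Sum>w = i..<n. \<Sum>v = Suc w..n. t ^ (v - Suc w) * E h' w v / real (v - w))"
    unfolding SB_def SC_def
    using sum.atLeast_Suc_lessThan[OF step.hyps(2), of "\<lambda>w. \<Sum>v = Suc w..n. t ^ (v - Suc w) * E h' w v / real (v - w)"]
    by simp
  finally show ?case unfolding h'_def one_def D_def .
qed


section \<open>Swaps between nearby sites\<close>

text \<open>Telescoping along the indices outside \<open>Occ\<close>, which form a chain from
  \<open>0\<close> to \<open>k\<close>; the induction removes the last link.\<close>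

lemma abs_diff_le_sum_consecutive_holes:
  fixes g :: "nat \<Rightarrow> real"
  assumes "0 \<notin> Occ" "k \<notin> Occ"
  shows "\<bar>g 0 - g k\<bar> \<le> (\<Sum>(e, d)\<in>{(e, d). e < d \<and> d \<le> k \<and> e \<notin> Occ \<and> d \<notin> Occ \<and> {e<..<d} \<subseteq> Occ}. \<bar>g e - g d\<bar>)"
  using assms(2)
proof (induction k rule: less_induct)
  case (less k)
  let ?P = "\<lambda>k. {(e, d). e < d \<and> d \<le> k \<and> e \<notin> Occ \<and> d \<notin> Occ \<and> {e<..<d} \<subseteq> Occ}"
  have finP: "finite (?P k)" for k
    by (rule finite_subset[of _ "{..k} \<times> {..k}"]) auto
  show ?case
  proof (cases "k = 0")
    case True
    have "0 \<le> (\<Sum>(e, d)\<in>?P 0. \<bar>g e - g d\<bar>)" by (rule sum_nonneg) auto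
    then show ?thesis unfolding True by simp
  next
    case False
    define e where "e = Max {j. j < k \<and> j \<notin> Occ}"
    have ne: "finite {j. j < k \<and> j \<notin> Occ}" "{j. j < k \<and> j \<notin> Occ} \<noteq> {}"
      using False assms(1) by auto
    have e: "e < k" "e \<notin> Occ" using Max_in[OF ne] by (auto simp: e_def)
    have "j \<in> Occ" if "e < j" "j < k" for j
      using Max_ge[OF ne(1), of j] that by (force simp: e_def[symmetric])
    then have ek: "(e, k) \<in> ?P k" using e less.prems by auto
    have sub: "insert (e, k) (?P e) \<subseteq> ?P k" using ek e by auto
    have "\<bar>g 0 - g k\<bar> \<le> \<bar>g e - g k\<bar> + \<bar>g 0 - g e\<bar>" by linarith
    also have "\<dots> \<le> \<bar>g e - g k\<bar> + (\<Sum>(e, d)\<in>?P e. \<bar>g e - g d\<bar>)"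
      using less.IH[OF e] by simp
    also have "\<dots> = (\<Sum>(e, d)\<in>insert (e, k) (?P e). \<bar>g e - g d\<bar>)"
      using finP e by (subst sum.insert) auto
    also have "\<dots> \<le> (\<Sum>(e, d)\<in>?P k. \<bar>g e - g d\<bar>)"
      by (rule sum_mono2[OF finP sub]) auto
    finally show ?thesis .
  qed
qed

text \<open>Between two consecutive holes \<open>p e\<close>, \<open>p d\<close> the hole travels backwards through the run of particles.
  Every intermediate configuration differs from \<open>S\<close> in at most four sites, which keeps the weight
  ratio bounded by \<open>M ^ 4\<close> however long the run is.\<close>

lemma swap_energy_hole_through_run:
  fixes f :: "'v set \<Rightarrow> real" and p :: "nat \<Rightarrow> 'v"
  assumes fin: "finite \<Lambda>" and inj: "inj_on p {..n}" and sub: "p ` {..n} \<subseteq> \<Lambda>"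
    and l: "\<And>z. 1 / M \<le> l z" "\<And>z. l z \<le> M" and M: "M \<ge> 1"
    and ed: "e < d" "d \<le> n"
  shows "(\<Sum>S\<in>{S. S \<subseteq> \<Lambda> - {p e, p d} \<and> p ` {e<..<d} \<subseteq> S}. prod l S * (f (insert (p e) S) - f (insert (p d) S))\<^sup>2)
     \<le> M ^ 4 * real (d - e) * (\<Sum>j = e..<d. swap_energy \<Lambda> l f (p j) (p (Suc j)))"
proof -
  let ?R = "{S. S \<subseteq> \<Lambda> - {p e, p d} \<and> p ` {e<..<d} \<subseteq> S}"
  have pe: "p a = p b \<longleftrightarrow> a = b" if "a \<le> n" "b \<le> n" for a b
    using inj that by (auto simp: inj_on_def)
  have lpos: "l z > 0" for z using l(1)[of z] M by (smt (verit) zero_less_divide_1_iff)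
  define w where "w S = insert (p e) (insert (p d) S)" for S
  define T where "T j S = w S - {p j, p (Suc j)}" for j S
  have finR: "finite ?R" using fin by simp
  have run: "p j \<in> w S" if "S \<in> ?R" "e \<le> j" "j \<le> d" for j S
  proof (cases "j = e \<or> j = d")
    case False
    then have "p j \<in> p ` {e<..<d}" using that by auto
    then show ?thesis using that by (auto simp: w_def)
  qed (auto simp: w_def)
  have ne: "p e \<noteq> p d" using pe[of e d] ed by auto
  have step: "(f (insert (p e) S) - f (insert (p d) S))\<^sup>2
      \<le> real (d - e) * (\<Sum>j = e..<d. (f (insert (p j) (T j S)) - f (insert (p (Suc j)) (T j S)))\<^sup>2)"
    if S: "S \<in> ?R" for S
  proof -
    \<comment> \<open>With both ends filled in, exactly one site of \<open>w S\<close> is removed,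
      and its position runs between \<open>p d\<close> and \<open>p e\<close>. The sum telescopes in
      this position, and each summand is a neighbour swap in the environment
      \<open>T j S\<close>.\<close>
    have "(\<Sum>j = e..<d. f (w S - {p (Suc j)}) - f (w S - {p j})) = f (w S - {p d}) - f (w S - {p e})"
      using ed by (simp add: sum_Suc_diff'[where f = "\<lambda>j. f (w S - {p j})"])
    moreover have "w S - {p d} = insert (p e) S" "w S - {p e} = insert (p d) S"
      using S ne by (auto simp: w_def)
    moreover have "w S - {p (Suc j)} = insert (p j) (T j S)" "w S - {p j} = insert (p (Suc j)) (T j S)"
      if "j \<in> {e..<d}" for j
      using run[OF S, of j] run[OF S, of "Suc j"] pe[of j "Suc j"] that ed by (auto simp: T_def)
    ultimately have "f (insert (p e) S) - f (insert (p d) S)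
        = (\<Sum>j = e..<d. f (insert (p j) (T j S)) - f (insert (p (Suc j)) (T j S)))" by simp
    moreover have "(\<Sum>j = e..<d. f (insert (p j) (T j S)) - f (insert (p (Suc j)) (T j S)))\<^sup>2
      \<le> (\<Sum>j = e..<d. (f (insert (p j) (T j S)) - f (insert (p (Suc j)) (T j S)))\<^sup>2) * real (card {e..<d})"
      using sum_squared_le_sum_of_squares[of "\<lambda>j. f (insert (p j) (T j S)) - f (insert (p (Suc j)) (T j S))" "{e..<d}"]
      by (simp add: mult.commute)
    ultimately show ?thesis by (simp add: mult.commute)
  qed
  have weight: "prod l S \<le> M ^ 4 * prod l (T j S)" if S: "S \<in> ?R" and j: "j \<in> {e..<d}" for S j
  proof -
    have fS: "finite S" using S fin finite_subset by auto
    have "prod l (w S) = l (p e) * l (p d) * prod l S"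
      unfolding w_def using S ne fS by (subst prod.insert, simp, force)+ (auto simp: mult.assoc)
    moreover have "w S = insert (p j) (insert (p (Suc j)) (T j S))"
      using run[OF S, of j] run[OF S, of "Suc j"] j by (auto simp: T_def)
    moreover have "prod l (insert (p j) (insert (p (Suc j)) (T j S))) = l (p j) * l (p (Suc j)) * prod l (T j S)"
      using fS pe[of j "Suc j"] j ed by (simp add: T_def w_def)
    ultimately have eq: "l (p e) * l (p d) * prod l S = l (p j) * l (p (Suc j)) * prod l (T j S)" by simp
    have "1 / M * (1 / M) \<le> l (p e) * l (p d)"
      using M by (intro mult_mono l less_imp_le[OF lpos]) auto
    then have "1 / M * (1 / M) * prod l S \<le> l (p e) * l (p d) * prod l S"
      by (rule mult_right_mono) (simp add: prod_nonneg less_imp_le[OF lpos])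
    also have "\<dots> \<le> M * M * prod l (T j S)" unfolding eq
      using M by (intro mult_right_mono mult_mono l less_imp_le[OF lpos] prod_nonneg) auto
    finally have "M * M * (1 / M * (1 / M) * prod l S) \<le> M * M * (M * M * prod l (T j S))"
      using M by (intro mult_left_mono) auto
    then show ?thesis using M by (simp add: power4_eq_xxxx mult.assoc)
  qed
  \<comment> \<open>\<open>T j S\<close> together with its two sites gives back \<open>w S\<close>,
    hence \<open>S\<close>; no environment of the edge is counted twice.\<close>
  have inj_T: "inj_on (T j) ?R" if j: "j \<in> {e..<d}" for j
  proof (rule inj_onI)
    fix S S' assume S: "S \<in> ?R" "S' \<in> ?R" "T j S = T j S'"
    have "w S = insert (p j) (insert (p (Suc j)) (T j S))" if "S \<in> ?R" for S
      using run[OF that, of j] run[OF that, of "Suc j"] j by (auto simp: T_def)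
    then have "w S = w S'" using S by simp
    moreover have "S = w S - {p e, p d}" if "S \<in> ?R" for S using that by (auto simp: w_def)
    ultimately show "S = S'" using S by metis
  qed
  have en: "(\<Sum>S\<in>?R. prod l (T j S) * (f (insert (p j) (T j S)) - f (insert (p (Suc j)) (T j S)))\<^sup>2)
      \<le> swap_energy \<Lambda> l f (p j) (p (Suc j))" if j: "j \<in> {e..<d}" for j
  proof -
    have "(\<Sum>S\<in>?R. prod l (T j S) * (f (insert (p j) (T j S)) - f (insert (p (Suc j)) (T j S)))\<^sup>2)
      = (\<Sum>S\<in>T j ` ?R. prod l S * (f (insert (p j) S) - f (insert (p (Suc j)) S))\<^sup>2)"
      using inj_T[OF j] by (simp add: sum.reindex)
    also have "\<dots> \<le> swap_energy \<Lambda> l f (p j) (p (Suc j))"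
      unfolding swap_energy_def
    proof (rule sum_mono2)
      have "p e \<in> \<Lambda>" "p d \<in> \<Lambda>" using sub ed by auto
      then show "T j ` ?R \<subseteq> Pow (\<Lambda> - {p j, p (Suc j)})" by (auto simp: T_def w_def)
    qed (use fin in \<open>auto simp: prod_nonneg less_imp_le[OF lpos]\<close>)
    finally show ?thesis .
  qed
  have "(\<Sum>S\<in>?R. prod l S * (f (insert (p e) S) - f (insert (p d) S))\<^sup>2)
    \<le> (\<Sum>S\<in>?R. \<Sum>j = e..<d. M ^ 4 * real (d - e) * (prod l (T j S) * (f (insert (p j) (T j S)) - f (insert (p (Suc j)) (T j S)))\<^sup>2))"
  proof (rule sum_mono)
    fix S assume S: "S \<in> ?R"
    have "prod l S * (f (insert (p e) S) - f (insert (p d) S))\<^sup>2 \<le> prod l S * (real (d - e) *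
        (\<Sum>j = e..<d. (f (insert (p j) (T j S)) - f (insert (p (Suc j)) (T j S)))\<^sup>2))"
      using step[OF S] by (intro mult_left_mono) (auto simp: prod_nonneg less_imp_le[OF lpos])
    also have "\<dots> = (\<Sum>j = e..<d. prod l S * (real (d - e) * (f (insert (p j) (T j S)) - f (insert (p (Suc j)) (T j S)))\<^sup>2))"
      by (simp add: sum_distrib_left)
    also have "\<dots> \<le> (\<Sum>j = e..<d. M ^ 4 * prod l (T j S) * (real (d - e) * (f (insert (p j) (T j S)) - f (insert (p (Suc j)) (T j S)))\<^sup>2))"
      using weight[OF S] by (intro sum_mono mult_right_mono) auto
    finally show "prod l S * (f (insert (p e) S) - f (insert (p d) S))\<^sup>2 \<le>
      (\<Sum>j = e..<d. M ^ 4 * real (d - e) * (prod l (T j S) * (f (insert (p j) (T j S)) - f (insert (p (Suc j)) (T j S)))\<^sup>2))"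
      by (simp add: mult_ac)
  qed
  also have "\<dots> = M ^ 4 * real (d - e) * (\<Sum>j = e..<d. \<Sum>S\<in>?R. prod l (T j S) * (f (insert (p j) (T j S)) - f (insert (p (Suc j)) (T j S)))\<^sup>2)"
    by (subst sum.swap) (simp add: sum_distrib_left)
  also have "\<dots> \<le> M ^ 4 * real (d - e) * (\<Sum>j = e..<d. swap_energy \<Lambda> l f (p j) (p (Suc j)))"
    using en M by (intro mult_left_mono sum_mono) auto
  finally show ?thesis .
qed

text \<open>The power of \<open>n\<close>: Cauchy--Schwarz over at most \<open>n ^ 2\<close> pairs
  of consecutive holes, a sum over \<open>n ^ 2\<close> possible pairs, and \<open>n\<close> for
  crossing one run. Any polynomial would do, since the bound is applied only between consecutive
  good sites.\<close>

lemma swap_energy_le_polynomial: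
  fixes f :: "'v set \<Rightarrow> real" and p :: "nat \<Rightarrow> 'v"
  assumes fin: "finite \<Lambda>" and inj: "inj_on p {..n}" and sub: "p ` {..n} \<subseteq> \<Lambda>"
    and l: "\<And>z. 1 / M \<le> l z" "\<And>z. l z \<le> M" and M: "M \<ge> 1" and n: "n > 0"
  shows "swap_energy \<Lambda> l f (p 0) (p n)
     \<le> M ^ 4 * real n ^ 5 * (\<Sum>j<n. swap_energy \<Lambda> l f (p j) (p (Suc j)))"
proof -
  let ?I = "{..<n} \<times> {1..n}"
  let ?R = "\<lambda>e d. {S. S \<subseteq> \<Lambda> - {p e, p d} \<and> p ` {e<..<d} \<subseteq> S}"
  define D where "D e d S = (f (insert (p e) S) - f (insert (p d) S))\<^sup>2" for e d S
  define X where "X = (\<Sum>j<n. swap_energy \<Lambda> l f (p j) (p (Suc j)))"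
  define Q where "Q S = {(e, d). e < d \<and> d \<le> n \<and> p e \<notin> S \<and> p d \<notin> S \<and> p ` {e<..<d} \<subseteq> S}" for S
  have lpos: "l z > 0" for z using l(1)[of z] M by (smt (verit) zero_less_divide_1_iff)
  have en0: "swap_energy \<Lambda> l f x y \<ge> 0" for x y by (rule swap_energy_nonneg) (simp add: less_imp_le lpos)
  have QI: "Q S \<subseteq> ?I" for S by (auto simp: Q_def)
  have finQ: "finite (Q S)" for S using QI by (rule finite_subset) simp
  have cardQ: "real (card (Q S)) \<le> real n ^ 2" for S
  proof -
    have "card (Q S) \<le> card ?I" using QI by (rule card_mono[rotated]) simp
    then have "card (Q S) \<le> n * n" by (simp add: card_cartesian_product)
    then show ?thesis by (metis of_nat_le_iff of_nat_mult power2_eq_square)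
  qed
  have path: "D 0 n S \<le> real n ^ 2 * (\<Sum>(e, d)\<in>Q S. D e d S)" if S: "S \<in> Pow (\<Lambda> - {p 0, p n})" for S
  proof -
    define g where "g j = f (insert (p j) S)" for j
    have "\<bar>g 0 - g n\<bar> \<le> (\<Sum>(e, d)\<in>Q S. \<bar>g e - g d\<bar>)"
      using abs_diff_le_sum_consecutive_holes[of "{j. p j \<in> S}" n g] S
      by (auto simp: Q_def subset_eq)
    then have "(g 0 - g n)\<^sup>2 \<le> (\<Sum>(e, d)\<in>Q S. \<bar>g e - g d\<bar>)\<^sup>2"
      by (metis abs_ge_zero power2_abs power_mono)
    also have "\<dots> \<le> real (card (Q S)) * (\<Sum>(e, d)\<in>Q S. \<bar>g e - g d\<bar>\<^sup>2)"
      using sum_squared_le_sum_of_squares[of "\<lambda>(e, d). \<bar>g e - g d\<bar>" "Q S"]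
      by (simp add: case_prod_unfold mult.commute)
    also have "\<dots> \<le> real n ^ 2 * (\<Sum>(e, d)\<in>Q S. \<bar>g e - g d\<bar>\<^sup>2)"
      by (rule mult_right_mono[OF cardQ]) (auto intro: sum_nonneg)
    finally show ?thesis by (simp add: g_def D_def)
  qed
  have "swap_energy \<Lambda> l f (p 0) (p n) = (\<Sum>S\<in>Pow (\<Lambda> - {p 0, p n}). prod l S * D 0 n S)"
    by (simp add: swap_energy_def D_def)
  also have "\<dots> \<le> (\<Sum>S\<in>Pow (\<Lambda> - {p 0, p n}). prod l S * (real n ^ 2 * (\<Sum>(e, d)\<in>Q S. D e d S)))"
    using path by (intro sum_mono mult_left_mono) (auto simp: prod_nonneg less_imp_le[OF lpos])
  \<comment> \<open>Admitting all subsets of \<open>\<Lambda>\<close> prepares the exchange of sums: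
    for a fixed pair of holes, the environments needed may contain \<open>p 0\<close> or
    \<open>p n\<close>.\<close>
  also have "\<dots> \<le> (\<Sum>S\<in>Pow \<Lambda>. prod l S * (real n ^ 2 * (\<Sum>(e, d)\<in>Q S. D e d S)))"
    using fin by (intro sum_mono2) (auto intro!: mult_nonneg_nonneg sum_nonneg simp: D_def prod_nonneg less_imp_le[OF lpos])
  also have "\<dots> = real n ^ 2 * (\<Sum>S\<in>Pow \<Lambda>. \<Sum>(e, d)\<in>Q S. prod l S * D e d S)"
    by (simp add: sum_distrib_left mult_ac case_prod_unfold)
  also have "(\<Sum>S\<in>Pow \<Lambda>. \<Sum>(e, d)\<in>Q S. prod l S * D e d S)
      = (\<Sum>S\<in>Pow \<Lambda>. \<Sum>i\<in>?I. if i \<in> Q S then prod l S * D (fst i) (snd i) S else 0)"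
  proof (rule sum.cong[OF refl])
    fix S
    have "(\<Sum>(e, d)\<in>Q S. prod l S * D e d S) = (\<Sum>i\<in>?I \<inter> Q S. prod l S * D (fst i) (snd i) S)"
      using QI[of S] by (simp add: case_prod_unfold Int_absorb1)
    then show "(\<Sum>(e, d)\<in>Q S. prod l S * D e d S)
        = (\<Sum>i\<in>?I. if i \<in> Q S then prod l S * D (fst i) (snd i) S else 0)"
      by (simp only: sum.inter_restrict finite_cartesian_product finite_lessThan finite_atLeastAtMost)
  qed
  also have "\<dots> = (\<Sum>i\<in>?I. \<Sum>S\<in>Pow \<Lambda>. if i \<in> Q S then prod l S * D (fst i) (snd i) S else 0)"
    by (rule sum.swap)
  also have "\<dots> \<le> (\<Sum>i\<in>?I. M ^ 4 * real n * X)"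
  proof (rule sum_mono)
    fix i assume "i \<in> ?I"
    obtain e d where i: "i = (e, d)" by fastforce
    show "(\<Sum>S\<in>Pow \<Lambda>. if i \<in> Q S then prod l S * D (fst i) (snd i) S else 0) \<le> M ^ 4 * real n * X"
    proof (cases "e < d \<and> d \<le> n")
      case False
      then have "i \<notin> Q S" for S by (auto simp: Q_def i)
      then show ?thesis using M en0 by (simp add: X_def sum_nonneg)
    next
      case True
      have R: "{S \<in> Pow \<Lambda>. i \<in> Q S} = ?R e d" using True by (auto simp: Q_def i)
      have "(\<Sum>S\<in>Pow \<Lambda>. if i \<in> Q S then prod l S * D (fst i) (snd i) S else 0)
          = (\<Sum>S\<in>{S \<in> Pow \<Lambda>. i \<in> Q S}. prod l S * D (fst i) (snd i) S)"
        by (rule sum.inter_filter[symmetric]) (simp add: fin)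
      also have "\<dots> = (\<Sum>S\<in>?R e d. prod l S * D e d S)" unfolding R by (simp add: i)
      also have "\<dots> \<le> M ^ 4 * real (d - e) * (\<Sum>j = e..<d. swap_energy \<Lambda> l f (p j) (p (Suc j)))"
        unfolding D_def by (rule swap_energy_hole_through_run[OF fin inj sub l M]) (use True in auto)
      also have "\<dots> \<le> M ^ 4 * real n * X"
        unfolding X_def using True M en0
        by (intro mult_mono sum_mono2) (auto intro!: sum_nonneg mult_nonneg_nonneg)
      finally show ?thesis .
    qed
  qed
  also have "\<dots> = real n ^ 2 * (M ^ 4 * real n * X)" by (simp add: power2_eq_square)
  finally have "swap_energy \<Lambda> l f (p 0) (p n) \<le> real n ^ 2 * (real n ^ 2 * (M ^ 4 * real n * X))"
    by (simp add: mult_left_mono)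
  moreover have "real n ^ 2 * (real n ^ 2 * (M ^ 4 * real n * X)) = M ^ 4 * (real n ^ 2 * real n ^ 2 * real n) * X"
    by (simp only: mult_ac)
  moreover have "real n ^ 2 * real n ^ 2 * real n = real n ^ 5" by (simp add: eval_nat_numeral)
  ultimately show ?thesis by (simp only: X_def)
qed


section \<open>The moving particle lemma\<close>

lemma summable_Suc_power_times_geometric:
  fixes t :: real
  assumes "0 \<le> t" "t < 1"
  shows "summable (\<lambda>k. real (Suc k) ^ m * t ^ k)"
proof -
  \<comment> \<open>Any ratio strictly between \<open>t\<close> and \<open>1\<close> works, as the
    polynomial part has ratio tending to \<open>1\<close>.\<close>
  define c where "c = (1 + t) / 2"
  have c: "t < c" "c < 1" using assms by (auto simp: c_def)
  have "(\<lambda>k. real (Suc (Suc k)) / real (Suc k)) \<longlonglongrightarrow> 1"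
    using LIMSEQ_Suc[OF LIMSEQ_Suc_n_over_n] by simp
  then have "(\<lambda>k. (real (Suc (Suc k)) / real (Suc k)) ^ m * t) \<longlonglongrightarrow> 1 ^ m * t"
    by (intro tendsto_intros)
  then have "eventually (\<lambda>k. (real (Suc (Suc k)) / real (Suc k)) ^ m * t < c) sequentially"
    using c(1) by (intro order_tendstoD(2)[where y = t]) auto
  then obtain N where N: "\<And>k. k \<ge> N \<Longrightarrow> (real (Suc (Suc k)) / real (Suc k)) ^ m * t < c"
    unfolding eventually_sequentially by blast
  show ?thesis
  proof (rule summable_ratio_test[OF c(2)])
    fix k assume "k \<ge> N"
    have "real (Suc (Suc k)) ^ m * t ^ Suc k
        = ((real (Suc (Suc k)) / real (Suc k)) ^ m * t) * (real (Suc k) ^ m * t ^ k)"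
      by (simp add: power_divide del: of_nat_Suc)
    also have "\<dots> \<le> c * (real (Suc k) ^ m * t ^ k)"
      using N[OF \<open>k \<ge> N\<close>] assms(1) by (intro mult_right_mono) auto
    finally show "norm (real (Suc (Suc k)) ^ m * t ^ Suc k) \<le> c * norm (real (Suc k) ^ m * t ^ k)"
      using assms(1) by simp
  qed
qed

text \<open>An index \<open>j\<close> lies in at most \<open>k\<close> intervals of length
  \<open>k\<close>, which accounts for the factor \<open>Suc k\<close> beside
  \<open>b (Suc k)\<close>.\<close>

lemma sum_intervals_le:
  fixes b X :: "nat \<Rightarrow> real"
  assumes b: "\<And>k. b k \<ge> 0" and X: "\<And>k. X k \<ge> 0"
  shows "(\<Sum>u<n. \<Sum>v = Suc u..n. b (v - u) * (\<Sum>j = u..<v. X j))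
    \<le> (\<Sum>k<n. real (Suc k) * b (Suc k)) * (\<Sum>j<n. X j)"
proof -
  \<comment> \<open>Extending \<open>X\<close> by zero from \<open>n\<close> on lets every shifted
    window be summed over a full range.\<close>
  define Y where "Y j = (if j < n then X j else 0)" for j
  have Y: "Y j \<ge> 0" for j using X by (simp add: Y_def)
  have "(\<Sum>v = Suc u..n. b (v - u) * (\<Sum>j = u..<v. X j)) \<le> (\<Sum>k<n. b (Suc k) * (\<Sum>i<Suc k. Y (u + i)))" for u
  proof -
    have "(\<Sum>v = Suc u..n. b (v - u) * (\<Sum>j = u..<v. X j))
        = (\<Sum>k\<in>{..<n - u}. b (Suc k) * (\<Sum>i<Suc k. Y (u + i)))"
    proof (rule sum.reindex_bij_witness[of _ "\<lambda>k. u + Suc k" "\<lambda>v. v - Suc u"])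
      fix v assume v: "v \<in> {Suc u..n}"
      have "(\<Sum>i<v - u. Y (u + i)) = (\<Sum>j = u..<v. X j)"
        by (rule sum.reindex_bij_witness[of _ "\<lambda>j. j - u" "\<lambda>i. u + i"]) (use v in \<open>auto simp: Y_def\<close>)
      then show "b (Suc (v - Suc u)) * (\<Sum>i<Suc (v - Suc u). Y (u + i)) = b (v - u) * (\<Sum>j = u..<v. X j)"
        using v by (simp add: Suc_diff_Suc)
    qed auto
    also have "\<dots> \<le> (\<Sum>k<n. b (Suc k) * (\<Sum>i<Suc k. Y (u + i)))"
      by (rule sum_mono2) (use b Y in \<open>auto intro!: mult_nonneg_nonneg sum_nonneg add_nonneg_nonneg\<close>)
    finally show ?thesis .
  qed
  then have "(\<Sum>u<n. \<Sum>v = Suc u..n. b (v - u) * (\<Sum>j = u..<v. X j))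
      \<le> (\<Sum>u<n. \<Sum>k<n. b (Suc k) * (\<Sum>i<Suc k. Y (u + i)))"
    by (rule sum_mono)
  also have "\<dots> = (\<Sum>k<n. b (Suc k) * (\<Sum>i<Suc k. \<Sum>u<n. Y (u + i)))"
    by (subst sum.swap, simp only: sum_distrib_left[symmetric], subst (2) sum.swap, rule refl)
  also have "\<dots> \<le> (\<Sum>k<n. b (Suc k) * (\<Sum>i<Suc k. \<Sum>j<n. X j))"
  proof (rule sum_mono, rule mult_left_mono[OF sum_mono b])
    fix i
    have "(\<Sum>u<n. Y (u + i)) = (\<Sum>j\<in>{i..<n + i}. Y j)"
      by (rule sum.reindex_bij_witness[of _ "\<lambda>j. j - i" "\<lambda>u. u + i"]) auto
    also have "\<dots> \<le> (\<Sum>j\<in>{..<n + i}. Y j)" by (rule sum_mono2) (use Y in auto)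
    also have "\<dots> = (\<Sum>j<n. X j)"
      by (rule sum.mono_neutral_cong_right) (auto simp: Y_def)
    finally show "(\<Sum>u<n. Y (u + i)) \<le> (\<Sum>j<n. X j)" .
  qed
  also have "\<dots> = (\<Sum>k<n. real (Suc k) * b (Suc k)) * (\<Sum>j<n. X j)"
    unfolding sum_distrib_right by (simp add: mult_ac)
  finally show ?thesis .
qed

text \<open>The cost is linear in \<open>n\<close>, with a constant depending on \<open>M\<close>
  alone: the geometric factors of the path expansion absorb the polynomial cost of each segment, and
  the only length that survives is the Cauchy--Schwarz factor of the whole path.\<close>

lemma moving_particle:
  fixes M :: real
  assumes M: "M \<ge> 1"
  obtains C :: real where "C \<ge> 0"
    "\<And>(\<Lambda> :: 'v set) (l :: 'v \<Rightarrow> real) f (p :: nat \<Rightarrow> 'v) n. finite \<Lambda> \<Longrightarrow> inj_on p {..n} \<Longrightarrow> p ` {..n} \<subseteq> \<Lambda> \<Longrightarrow>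
       (\<And>z. 1 / M \<le> l z) \<Longrightarrow> (\<And>z. l z \<le> M) \<Longrightarrow>
       swap_energy \<Lambda> l f (p 0) (p n) \<le> C * real n * (\<Sum>j<n. swap_energy \<Lambda> l f (p j) (p (Suc j)))"
proof -
  \<comment> \<open>Since weights are at most \<open>M\<close>, removing \<open>1 / M\<close> takes
    away at least the fraction \<open>1 / M ^ 2\<close> of each weight.\<close>
  define t where "t = 1 - 1 / M\<^sup>2"
  have t: "0 \<le> t" "t < 1" using M by (auto simp: t_def)
  \<comment> \<open>Exponent six: five for crossing a segment and one for the number of segments of
    given length covering an edge. The \<open>M ^ 6\<close> in \<open>C\<close> is
    \<open>M ^ 4\<close> from the crossing and one \<open>M\<close> for each flattened end
    \<open>p 0\<close>, \<open>p n\<close>.\<close>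
  define s where "s k = real (Suc k) ^ 6 * t ^ k" for k
  have sum_s: "summable s" unfolding s_def by (rule summable_Suc_power_times_geometric[OF t])
  have s0: "s k \<ge> 0" for k using t by (simp add: s_def)
  define C where "C = M ^ 6 * suminf s"
  show thesis
  proof (rule that)
    show "C \<ge> 0" using M s0 by (simp add: C_def suminf_nonneg sum_s)
  next
    fix \<Lambda> :: "'v set" and l :: "'v \<Rightarrow> real" and f and p :: "nat \<Rightarrow> 'v" and n
    assume fin: "finite \<Lambda>" and inj: "inj_on p {..n}" and sub: "p ` {..n} \<subseteq> \<Lambda>"
      and l: "\<And>z. 1 / M \<le> l z" "\<And>z. l z \<le> M"
    define e where "e j = swap_energy \<Lambda> l f (p j) (p (Suc j))" for j
    have lpos: "l z > 0" for z using l(1)[of z] M by (smt (verit) zero_less_divide_1_iff)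
    have e0: "e j \<ge> 0" for j unfolding e_def by (rule swap_energy_nonneg) (simp add: less_imp_le lpos)
    define h :: "'v \<Rightarrow> bool \<Rightarrow> real" where "h = (\<lambda>z s. if s then l z else 1)"
    have hb: "1 / M \<le> h z s" "h z s \<le> M" for z s using l[of z] M by (auto simp: h_def)
    have h0: "h z s \<ge> 0" for z s using hb(1)[of z s] M by (smt (verit) zero_le_divide_1_iff)
    show "swap_energy \<Lambda> l f (p 0) (p n) \<le> C * real n * (\<Sum>j<n. swap_energy \<Lambda> l f (p j) (p (Suc j)))"
    proof (cases "n = 0")
      case True
      then show ?thesis by (simp add: swap_energy_def)
    next
      case False
      define h' where "h' = h(p 0 := \<lambda>_. 1, p n := \<lambda>_. 1)"
      define E where "E = (\<lambda>u v. two_state_energy \<Lambda> h' f (p u) (p v))"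
      have Ele: "E u v \<le> M ^ 6 * real (v - u) ^ 5 * (\<Sum>j = u..<v. e j)" if uv: "u < v" "v \<le> n" for u v
      proof -
        have in\<Lambda>: "p 0 \<in> \<Lambda>" "p n \<in> \<Lambda>" using sub by auto
        have one: "1 \<le> M * h z s" for z s using mult_left_mono[OF hb(1)[of z s], of M] M by simp
        have upd: "two_state_energy \<Lambda> (g(z := \<lambda>_. 1)) f x y \<le> M * two_state_energy \<Lambda> g f x y"
          if "z \<in> \<Lambda>" "\<And>z s. g z s \<ge> 0" "\<And>s. 1 \<le> M * g z s" for g z x y
        proof (cases "z = x \<or> z = y")
          case True
          then have "two_state_energy \<Lambda> (g(z := \<lambda>_. 1)) f x y = two_state_energy \<Lambda> g f x y"
            by (intro two_state_energy_cong) auto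
          then show ?thesis
            using M mult_right_mono[OF M two_state_energy_nonneg[of g \<Lambda> f x y]] that by simp
        next
          case False
          then show ?thesis by (intro two_state_energy_mono_scale fin that) auto
        qed
        have "E u v \<le> M * two_state_energy \<Lambda> (h(p 0 := \<lambda>_. 1)) f (p u) (p v)"
          unfolding E_def h'_def by (rule upd[OF in\<Lambda>(2)]) (use h0 one M in auto)
        also have "two_state_energy \<Lambda> (h(p 0 := \<lambda>_. 1)) f (p u) (p v) \<le> M * two_state_energy \<Lambda> h f (p u) (p v)"
          by (rule upd[OF in\<Lambda>(1)]) (use h0 one in auto)
        also have "two_state_energy \<Lambda> h f (p u) (p v) = swap_energy \<Lambda> l f (p u) (p v)"
          unfolding h_def by (rule two_state_energy_eq_swap_energy[OF fin])
        also have "\<dots> \<le> M ^ 4 * real (v - u) ^ 5 * (\<Sum>j<v - u. e (u + j))"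
        proof -
          have "inj_on (\<lambda>j. p (u + j)) {..v - u}"
          proof (rule inj_onI)
            fix x y assume "x \<in> {..v - u}" "y \<in> {..v - u}" "p (u + x) = p (u + y)"
            then show "x = y" using inj_onD[OF inj, of "u + x" "u + y"] uv by auto
          qed
          moreover have "(\<lambda>j. p (u + j)) ` {..v - u} \<subseteq> \<Lambda>" using sub uv by auto
          ultimately show ?thesis
            using swap_energy_le_polynomial[OF fin _ _ l M, where p = "\<lambda>j. p (u + j)" and n = "v - u" and f = f] uv
            by (simp add: e_def)
        qed
        also have "(\<Sum>j<v - u. e (u + j)) = (\<Sum>j = u..<v. e j)"
          by (rule sum.reindex_bij_witness[of _ "\<lambda>j. j - u" "\<lambda>j. u + j"]) (use uv in auto)
        finally have "E u v \<le> M * (M * (M ^ 4 * real (v - u) ^ 5 * (\<Sum>j = u..<v. e j)))"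
          using M by simp
        then show ?thesis by (simp add: eval_nat_numeral mult_ac)
      qed
      have "swap_energy \<Lambda> l f (p 0) (p n) = two_state_energy \<Lambda> h f (p 0) (p n)"
        unfolding h_def by (rule two_state_energy_eq_swap_energy[OF fin, symmetric])
      also have "\<dots> \<le> real (n - 0) *
        ((\<Sum>v = 1..n. t ^ (v - 1) * E 0 v / real (v - 0))
       + (\<Sum>w = 1..<n. \<Sum>v = Suc w..n. t ^ (v - Suc w) * E w v / real (v - w)))"
        unfolding E_def h'_def
      proof (rule two_state_energy_path_expansion[where k = "1 / M", OF fin inj sub])
        show "1 / M \<le> h (p j) s \<and> h (p j) s - 1 / M \<le> t * h (p j) s" for j s
        proof -
          have "h (p j) s / M\<^sup>2 \<le> M / M\<^sup>2" using hb(2)[of "p j" s] by (intro divide_right_mono) auto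
          then have "h (p j) s / M\<^sup>2 \<le> 1 / M" using M by (simp add: power2_eq_square)
          then show ?thesis using hb(1)[of "p j" s] by (simp add: t_def algebra_simps)
        qed
      qed (use M t h0 False in auto)
      \<comment> \<open>The sum over the first good site is the missing term \<open>w = 0\<close> of
        the double sum: the start of the path acts as a good site.\<close>
      also have "(\<Sum>v = 1..n. t ^ (v - 1) * E 0 v / real (v - 0))
          + (\<Sum>w = 1..<n. \<Sum>v = Suc w..n. t ^ (v - Suc w) * E w v / real (v - w))
        = (\<Sum>w<n. \<Sum>v = Suc w..n. t ^ (v - Suc w) * E w v / real (v - w))"
        using False sum.atLeast_Suc_lessThan[of 0 n "\<lambda>w. \<Sum>v = Suc w..n. t ^ (v - Suc w) * E w v / real (v - w)"]
        by (simp add: lessThan_atLeast0)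
      also have "\<dots> \<le> (\<Sum>w<n. \<Sum>v = Suc w..n. (M ^ 6 * t ^ (v - w - 1) * real (v - w) ^ 5) * (\<Sum>j = w..<v. e j))"
      proof (intro sum_mono)
        fix w v assume wv: "w \<in> {..<n}" "v \<in> {Suc w..n}"
        have X0: "(\<Sum>j = w..<v. e j) \<ge> 0" using e0 by (simp add: sum_nonneg)
        have E0: "E w v \<ge> 0" unfolding E_def h'_def by (rule two_state_energy_nonneg) (use h0 in auto)
        have "E w v / real (v - w) \<le> E w v / 1"
          using wv E0 by (intro divide_left_mono) auto
        then have "E w v / real (v - w) \<le> M ^ 6 * real (v - w) ^ 5 * (\<Sum>j = w..<v. e j)"
          using Ele[of w v] wv by simp
        then have "t ^ (v - Suc w) * (E w v / real (v - w)) \<le> t ^ (v - Suc w) * (M ^ 6 * real (v - w) ^ 5 * (\<Sum>j = w..<v. e j))"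
          using t by (intro mult_left_mono) auto
        then show "t ^ (v - Suc w) * E w v / real (v - w)
            \<le> (M ^ 6 * t ^ (v - w - 1) * real (v - w) ^ 5) * (\<Sum>j = w..<v. e j)"
          by (simp add: mult_ac)
      qed
      also have "\<dots> \<le> (\<Sum>k<n. real (Suc k) * (M ^ 6 * t ^ (Suc k - 1) * real (Suc k) ^ 5)) * (\<Sum>j<n. e j)"
        by (rule sum_intervals_le[where b = "\<lambda>g. M ^ 6 * t ^ (g - 1) * real g ^ 5"]) (use M t e0 in auto)
      also have "(\<Sum>k<n. real (Suc k) * (M ^ 6 * t ^ (Suc k - 1) * real (Suc k) ^ 5)) = M ^ 6 * (\<Sum>k<n. s k)"
        unfolding s_def sum_distrib_left by (rule sum.cong) (simp_all add: eval_nat_numeral mult_ac del: of_nat_Suc)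
      also have "\<dots> \<le> C"
        unfolding C_def using M by (intro mult_left_mono sum_le_suminf[OF sum_s]) (use s0 in auto)
      finally have "swap_energy \<Lambda> l f (p 0) (p n) \<le> real n * (C * (\<Sum>j<n. e j))"
        using e0 by (simp add: mult_left_mono mult_right_mono sum_nonneg)
      then show ?thesis unfolding e_def by (simp add: mult_ac)
    qed
  qed
qed


section \<open>Spectral gap of the mean-field dynamics\<close>

text \<open>By Cauchy--Schwarz \<open>k \<mapsto> \<parallel>P ^ k f\<parallel>\<^sup>2\<close> is log-convex, so its first ratio is at most
  the asymptotic rate \<open>r\<^sup>2\<close>.\<close>

lemma selfadjoint_contraction_quadratic_form:
  fixes w :: "'a \<Rightarrow> real" and P :: "('a \<Rightarrow> real) \<Rightarrow> 'a \<Rightarrow> real"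
  assumes fin: "finite X" and w: "\<And>s. w s \<ge> 0"
    and sa: "\<And>f g. (\<Sum>s\<in>X. w s * (f s * P g s)) = (\<Sum>s\<in>X. w s * (P f s * g s))"
    and decay: "\<And>k. (\<Sum>s\<in>X. w s * ((P ^^ k) f s)\<^sup>2) \<le> B * r ^ (2 * k)" and r: "0 < r"
  shows "(\<Sum>s\<in>X. w s * (f s * P f s)) \<le> r * (\<Sum>s\<in>X. w s * (f s)\<^sup>2)"
proof -
  have CS: "(\<Sum>s\<in>X. w s * (f s * g s))\<^sup>2 \<le> (\<Sum>s\<in>X. w s * (f s)\<^sup>2) * (\<Sum>s\<in>X. w s * (g s)\<^sup>2)" for f g
    using Cauchy_Schwarz_ineq_sum[of "\<lambda>s. sqrt (w s) * f s" "\<lambda>s. sqrt (w s) * g s" X] w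
    by (simp add: power_mult_distrib algebra_simps)
  define a where "a k = (\<Sum>s\<in>X. w s * ((P ^^ k) f s)\<^sup>2)" for k
  have a0: "a k \<ge> 0" for k unfolding a_def by (intro sum_nonneg mult_nonneg_nonneg w) auto
  have logconv: "(a (Suc k))\<^sup>2 \<le> a k * a (Suc (Suc k))" for k
  proof -
    have "a (Suc k) = (\<Sum>s\<in>X. w s * ((P ^^ k) f s * (P ^^ Suc (Suc k)) f s))"
      using sa[of "(P ^^ k) f" "(P ^^ Suc k) f"] by (simp add: a_def power2_eq_square)
    then show ?thesis using CS[of "(P ^^ k) f" "(P ^^ Suc (Suc k)) f"] by (simp add: a_def)
  qed
  have a1: "a 1 \<le> r\<^sup>2 * a 0"
  proof (rule ccontr)
    assume neg: "\<not> a 1 \<le> r\<^sup>2 * a 0"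
    have "a 0 \<noteq> 0"
    proof
      assume "a 0 = 0"
      then have "a 1 = 0" using logconv[of 0] by simp
      then show False using neg \<open>a 0 = 0\<close> by simp
    qed
    then have a0pos: "a 0 > 0" using a0[of 0] by simp
    \<comment> \<open>Log-convexity makes all later ratios at least the first ratio
      \<open>q\<close>. If \<open>q > r ^ 2\<close>, then \<open>a k\<close> outgrows the assumed
      decay.\<close>
    define q where "q = a 1 / a 0"
    have q: "q > r\<^sup>2" using neg a0pos by (simp add: q_def field_simps)
    have qpos: "q > 0" using q r by (smt (verit) zero_le_power2)
    have step: "a k > 0 \<and> a (Suc k) \<ge> q * a k" for k
    proof (induction k)
      case 0
      then show ?case using a0pos by (simp add: q_def)
    next
      case (Suc k)
      then have pos: "a (Suc k) > 0" using qpos by (smt (verit) mult_pos_pos)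
      have "q * a (Suc k) * a k \<le> a (Suc k) * a (Suc k)"
        using Suc mult_left_mono[of "q * a k" "a (Suc k)" "a (Suc k)"] pos by (simp add: mult_ac)
      also have "\<dots> \<le> a (Suc (Suc k)) * a k" using logconv[of k] by (simp add: power2_eq_square mult_ac)
      finally have "q * a (Suc k) \<le> a (Suc (Suc k))" using Suc by (simp add: mult_le_cancel_right)
      then show ?case using pos by simp
    qed
    have growth: "a k \<ge> q ^ k * a 0" for k
    proof (induction k)
      case (Suc k)
      have "q ^ Suc k * a 0 \<le> q * a k" using Suc qpos by (simp add: mult_left_mono mult.assoc)
      also have "\<dots> \<le> a (Suc k)" using step by blast
      finally show ?case .
    qed simp
    have bd: "(q / r\<^sup>2) ^ k \<le> B / a 0" for k
    proof -
      have "q ^ k * a 0 \<le> B * (r\<^sup>2) ^ k"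
        using growth[of k] decay[of k] by (simp add: a_def power_mult)
      then show ?thesis using a0pos r by (simp add: power_divide field_simps)
    qed
    have "1 < q / r\<^sup>2" using q r by simp
    then obtain k where "B / a 0 < (q / r\<^sup>2) ^ k" using real_arch_pow by blast
    then show False using bd[of k] by simp
  qed
  have "(\<Sum>s\<in>X. w s * (f s * P f s))\<^sup>2 \<le> a 0 * a 1"
    using CS[of f "P f"] by (simp add: a_def)
  also have "\<dots> \<le> a 0 * (r\<^sup>2 * a 0)" using a1 a0 by (intro mult_left_mono)
  also have "\<dots> = (r * a 0)\<^sup>2" by (simp add: power2_eq_square mult_ac)
  finally have "(\<Sum>s\<in>X. w s * (f s * P f s)) \<le> r * a 0"
    by (rule power2_le_imp_le) (use r a0 in auto)
  then show ?thesis by (simp add: a_def)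
qed

text \<open>The generator of the mean-field dynamics. The rate depends only on the target site,
  which makes the product weights reversible.\<close>

definition hop_sum :: "'v set \<Rightarrow> ('v \<Rightarrow> real) \<Rightarrow> ('v set \<Rightarrow> real) \<Rightarrow> 'v set \<Rightarrow> real" where
  "hop_sum \<Lambda> l f S = (\<Sum>x\<in>S. \<Sum>y\<in>\<Lambda> - S. l y * (f (insert y (S - {x})) - f S))"

text \<open>A configuration with a chosen particle \<open>x\<close> and hole \<open>y\<close> is
  recoded by the remaining particles \<open>R\<close>. A jump leaves \<open>R\<close> unchanged, so
  time reversal becomes the exchange of \<open>x\<close> and \<open>y\<close>.\<close>

lemma sum_particle_hole_reindex:
  fixes \<phi> :: "'v set \<Rightarrow> 'v \<Rightarrow> 'v \<Rightarrow> 'b::comm_monoid_add"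
  assumes fin: "finite \<Lambda>"
  shows "(\<Sum>S\<in>{S. S \<subseteq> \<Lambda> \<and> card S = N}. \<Sum>x\<in>S. \<Sum>y\<in>\<Lambda> - S. \<phi> S x y)
    = (\<Sum>x\<in>\<Lambda>. \<Sum>y\<in>\<Lambda> - {x}. \<Sum>R\<in>{R. R \<subseteq> \<Lambda> - {x, y} \<and> Suc (card R) = N}. \<phi> (insert x R) x y)"
proof -
  have fS: "finite S" if "S \<subseteq> \<Lambda>" for S using that fin finite_subset by blast
  let ?A = "SIGMA S:{S. S \<subseteq> \<Lambda> \<and> card S = N}. SIGMA x:S. \<Lambda> - S"
  let ?B = "SIGMA x:\<Lambda>. SIGMA y:\<Lambda> - {x}. {R. R \<subseteq> \<Lambda> - {x, y} \<and> Suc (card R) = N}"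
  have "(\<Sum>S\<in>{S. S \<subseteq> \<Lambda> \<and> card S = N}. \<Sum>x\<in>S. \<Sum>y\<in>\<Lambda> - S. \<phi> S x y)
      = (\<Sum>S\<in>{S. S \<subseteq> \<Lambda> \<and> card S = N}. \<Sum>(x, y)\<in>(SIGMA x:S. \<Lambda> - S). \<phi> S x y)"
    by (intro sum.cong refl sum.Sigma) (use fS fin in auto)
  also have "\<dots> = (\<Sum>(S, x, y)\<in>?A. \<phi> S x y)"
    by (subst sum.Sigma) (use fS fin in \<open>auto simp: case_prod_unfold\<close>)
  also have "\<dots> = (\<Sum>(x, y, R)\<in>?B. \<phi> (insert x R) x y)"
    by (rule sum.reindex_bij_witness[of _ "\<lambda>(x, y, R). (insert x R, x, y)" "\<lambda>(S, x, y). (x, y, S - {x})"])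
      (use fS in \<open>auto simp: insert_absorb card_Suc_Diff1 simp del: card_Diff_insert
        intro!: card_insert_disjoint\<close>)
  also have "\<dots> = (\<Sum>x\<in>\<Lambda>. \<Sum>(y, R)\<in>(SIGMA y:\<Lambda> - {x}. {R. R \<subseteq> \<Lambda> - {x, y} \<and> Suc (card R) = N}). \<phi> (insert x R) x y)"
    by (subst sum.Sigma) (use fin in \<open>auto simp: case_prod_unfold\<close>)
  also have "\<dots> = (\<Sum>x\<in>\<Lambda>. \<Sum>y\<in>\<Lambda> - {x}. \<Sum>R\<in>{R. R \<subseteq> \<Lambda> - {x, y} \<and> Suc (card R) = N}. \<phi> (insert x R) x y)"
    by (intro sum.cong refl sum.Sigma[symmetric]) (use fin in auto)
  finally show ?thesis .
qed

lemma sum_sum_Diff_commute: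
  fixes \<psi> :: "'v \<Rightarrow> 'v \<Rightarrow> 'b::comm_monoid_add"
  assumes "finite \<Lambda>"
  shows "(\<Sum>x\<in>\<Lambda>. \<Sum>y\<in>\<Lambda> - {x}. \<psi> x y) = (\<Sum>x\<in>\<Lambda>. \<Sum>y\<in>\<Lambda> - {x}. \<psi> y x)"
proof -
  have "(\<Sum>x\<in>\<Lambda>. \<Sum>y\<in>\<Lambda> - {x}. \<psi> x y) = (\<Sum>(x, y)\<in>(SIGMA x:\<Lambda>. \<Lambda> - {x}). \<psi> x y)"
    by (rule sum.Sigma) (use assms in auto)
  also have "\<dots> = (\<Sum>(x, y)\<in>(SIGMA x:\<Lambda>. \<Lambda> - {x}). \<psi> y x)"
    by (rule sum.reindex_bij_witness[of _ prod.swap prod.swap]) auto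
  also have "\<dots> = (\<Sum>x\<in>\<Lambda>. \<Sum>y\<in>\<Lambda> - {x}. \<psi> y x)"
    by (rule sum.Sigma[symmetric]) (use assms in auto)
  finally show ?thesis .
qed

text \<open>Detailed balance: configuration weight times jump rate is
  \<open>prod l R * l x * l y\<close>, symmetric in \<open>x\<close> and \<open>y\<close>. Averaging
  the sum with its exchanged copy produces the product of differences and the factor one
  half.\<close>

lemma hop_sum_Dirichlet_form:
  fixes l :: "'v \<Rightarrow> real"
  assumes fin: "finite \<Lambda>"
  shows "(\<Sum>S\<in>{S. S \<subseteq> \<Lambda> \<and> card S = N}. prod l S * (g S * hop_sum \<Lambda> l f S))
    = - (1 / 2) * (\<Sum>x\<in>\<Lambda>. \<Sum>y\<in>\<Lambda> - {x}. \<Sum>R\<in>{R. R \<subseteq> \<Lambda> - {x, y} \<and> Suc (card R) = N}.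
        prod l R * l x * l y * ((g (insert y R) - g (insert x R)) * (f (insert y R) - f (insert x R))))"
    (is "?L = _ * ?D")
proof -
  define \<psi> where "\<psi> x y = (\<Sum>R\<in>{R. R \<subseteq> \<Lambda> - {x, y} \<and> Suc (card R) = N}.
      prod l R * l x * l y * (g (insert x R) * (f (insert y R) - f (insert x R))))" for x y
  have fS: "finite S" if "S \<subseteq> \<Lambda>" for S using that fin finite_subset by blast
  have "?L = (\<Sum>S\<in>{S. S \<subseteq> \<Lambda> \<and> card S = N}. \<Sum>x\<in>S. \<Sum>y\<in>\<Lambda> - S.
      prod l S * (g S * (l y * (f (insert y (S - {x})) - f S))))"
    by (simp add: hop_sum_def sum_distrib_left)
  also have "\<dots> = (\<Sum>x\<in>\<Lambda>. \<Sum>y\<in>\<Lambda> - {x}. \<Sum>R\<in>{R. R \<subseteq> \<Lambda> - {x, y} \<and> Suc (card R) = N}.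
      prod l (insert x R) * (g (insert x R) * (l y * (f (insert y (insert x R - {x})) - f (insert x R)))))"
    by (rule sum_particle_hole_reindex[OF fin])
  also have "\<dots> = (\<Sum>x\<in>\<Lambda>. \<Sum>y\<in>\<Lambda> - {x}. \<psi> x y)"
    unfolding \<psi>_def
  proof (intro sum.cong refl)
    fix x y R assume "R \<in> {R. R \<subseteq> \<Lambda> - {x, y} \<and> Suc (card R) = N}"
    then have "x \<notin> R" "finite R" using fS[of R] by auto
    then show "prod l (insert x R) * (g (insert x R) * (l y * (f (insert y (insert x R - {x})) - f (insert x R))))
      = prod l R * l x * l y * (g (insert x R) * (f (insert y R) - f (insert x R)))"
      by (simp add: mult_ac)
  qed
  finally have L: "?L = (\<Sum>x\<in>\<Lambda>. \<Sum>y\<in>\<Lambda> - {x}. \<psi> x y)" .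
  then have L': "?L = (\<Sum>x\<in>\<Lambda>. \<Sum>y\<in>\<Lambda> - {x}. \<psi> y x)" by (subst sum_sum_Diff_commute[OF fin])
  have "2 * ?L = (\<Sum>x\<in>\<Lambda>. \<Sum>y\<in>\<Lambda> - {x}. \<psi> x y + \<psi> y x)"
    using L L' by (simp add: sum.distrib)
  also have "\<dots> = - ?D"
    unfolding \<psi>_def sum_negf[symmetric]
    by (intro sum.cong refl)
      (simp add: insert_commute sum.distrib[symmetric] sum_negf[symmetric] algebra_simps)
  finally show ?thesis by simp
qed

text \<open>Jumps sorted by their effect on the discrepancy: the particle at \<open>x\<close> goes
  to a common hole or to \<open>y\<close>; a particle of \<open>R\<close> goes to \<open>y\<close>
  or to a common hole. The coupling compares these four groups with those of
  \<open>insert y R\<close> one by one.\<close>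

lemma hop_sum_insert:
  assumes fin: "finite \<Lambda>" and R: "R \<subseteq> \<Lambda> - {x, y}" and xy: "x \<in> \<Lambda>" "y \<in> \<Lambda>" "x \<noteq> y"
  shows "hop_sum \<Lambda> l f (insert x R) =
      (\<Sum>v\<in>\<Lambda> - R - {x, y}. l v * (f (insert v R) - f (insert x R)))
    + l y * (f (insert y R) - f (insert x R))
    + (\<Sum>z\<in>R. l y * (f (insert x (insert y (R - {z}))) - f (insert x R)))
    + (\<Sum>z\<in>R. \<Sum>v\<in>\<Lambda> - R - {x, y}. l v * (f (insert x (insert v (R - {z}))) - f (insert x R)))"
proof -
  have finR: "finite R" and xR: "x \<notin> R" "y \<notin> R" using R fin finite_subset by auto
  have V: "\<Lambda> - insert x R = insert y (\<Lambda> - R - {x, y})" using xy R by auto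
  have sV: "(\<Sum>v\<in>\<Lambda> - insert x R. F v) = F y + (\<Sum>v\<in>\<Lambda> - R - {x, y}. F v)" for F :: "'a \<Rightarrow> real"
    unfolding V using fin by simp
  have 1: "insert x R - {x} = R" using xR by auto
  have 2: "insert v (insert x R - {z}) = insert x (insert v (R - {z}))" if "z \<in> R" for z v
    using that xR by auto
  have "hop_sum \<Lambda> l f (insert x R) = (\<Sum>v\<in>\<Lambda> - insert x R. l v * (f (insert v R) - f (insert x R)))
     + (\<Sum>z\<in>R. \<Sum>v\<in>\<Lambda> - insert x R. l v * (f (insert v (insert x R - {z})) - f (insert x R)))"
    unfolding hop_sum_def using finR xR 1 by simp
  also have "(\<Sum>z\<in>R. \<Sum>v\<in>\<Lambda> - insert x R. l v * (f (insert v (insert x R - {z})) - f (insert x R)))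
     = (\<Sum>z\<in>R. \<Sum>v\<in>\<Lambda> - insert x R. l v * (f (insert x (insert v (R - {z}))) - f (insert x R)))"
    by (intro sum.cong refl) (simp add: 2)
  finally show ?thesis unfolding sV by (simp add: sum.distrib)
qed

section \<open>Coupling and contraction of the Lipschitz seminorm\<close>

definition swap_lipschitz :: "'v set \<Rightarrow> nat \<Rightarrow> ('v set \<Rightarrow> real) \<Rightarrow> real \<Rightarrow> bool" where
  "swap_lipschitz \<Lambda> N f c \<longleftrightarrow> (\<forall>x\<in>\<Lambda>. \<forall>y\<in>\<Lambda>. \<forall>R. x \<noteq> y \<longrightarrow> R \<subseteq> \<Lambda> - {x, y} \<longrightarrow> Suc (card R) = N \<longrightarrow>
     \<bar>f (insert x R) - f (insert y R)\<bar> \<le> c)"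

lemma card_exchange:
  assumes "finite R" "z \<in> R" "v \<notin> R"
  shows "card (insert v (R - {z})) = card R"
proof -
  have "Suc (card (R - {z})) = card R" using assms by (intro card_Suc_Diff1)
  then show ?thesis using assms by simp
qed

text \<open>Couple two configurations \<open>R \<union> {x}\<close> and \<open>R \<union> {y}\<close>. Moves between common particles and common holes are
  made jointly; all moves of the discrepant particle, and the common part \<open>min (l x) (l y)\<close> of the
  moves of a particle of \<open>R\<close> to \<open>y\<close> respectively \<open>x\<close>, make the two configurations meet.\<close>

lemma swap_lipschitz_hop_sum:
  fixes l :: "'v \<Rightarrow> real"
  assumes fin: "finite \<Lambda>" and M: "M \<ge> 1" and l: "\<And>z. 1 / M \<le> l z" "\<And>z. l z \<le> M"
    and e: "e > 0" "e * (real (card \<Lambda>) ^ 2 * M) \<le> 1" and lip: "swap_lipschitz \<Lambda> N f c"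
  shows "swap_lipschitz \<Lambda> N (\<lambda>S. f S + e * hop_sum \<Lambda> l f S) ((1 - e * (real (card \<Lambda>) / M)) * c)"
proof -
  let ?n = "real (card \<Lambda>)"
  let ?P = "\<lambda>S. f S + e * hop_sum \<Lambda> l f S"
  have lpos: "l z > 0" for z using l(1)[of z] M by (smt (verit) zero_less_divide_1_iff)
  have one_sided: "?P (insert x R) - ?P (insert y R) \<le> (1 - e * (?n / M)) * c"
    if xy: "x \<in> \<Lambda>" "y \<in> \<Lambda>" "x \<noteq> y" and R: "R \<subseteq> \<Lambda> - {x, y}" and cR: "Suc (card R) = N" for x y R
  proof -
    define V where "V = \<Lambda> - R - {x, y}"
    define A where "A = sum l V"
    define g where "g = f (insert x R) - f (insert y R)"
    define mx where "mx = max (l x) (l y)"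
    define mn where "mn = min (l x) (l y)"
    define \<rho> where "\<rho> = real (card R)"
    define \<nu> where "\<nu> = real (card V)"
    have finR: "finite R" and finV: "finite V" and xR: "x \<notin> R" "y \<notin> R"
      using R fin finite_subset by (auto simp: V_def)
    have n: "?n = \<rho> + \<nu> + 2"
    proof -
      have "\<Lambda> = insert x (insert y (R \<union> V))" "x \<notin> insert y (R \<union> V)" "y \<notin> R \<union> V" "R \<inter> V = {}"
        using xy R by (auto simp: V_def)
      then have "card \<Lambda> = Suc (Suc (card R + card V))"
        using finR finV by (metis card_Un_disjoint card_insert_disjoint finite_UnI finite_insert)
      then show ?thesis by (simp add: \<rho>_def \<nu>_def)
    qed
    have gc: "g \<le> c" and c0: "c \<ge> 0"
      using lip xy R cR unfolding swap_lipschitz_def g_def by (smt (verit))+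
    have A: "\<nu> / M \<le> A" "A \<le> \<nu> * M"
      using sum_bounded_below[of V "1 / M" l] sum_bounded_above[of V l M] l
      by (auto simp: A_def \<nu>_def)
    have e1: "(\<Sum>v\<in>V. l v * (f (insert v R) - f (insert x R))) - (\<Sum>v\<in>V. l v * (f (insert v R) - f (insert y R)))
        = - A * g"
    proof -
      have "(\<Sum>v\<in>V. l v * (f (insert v R) - f (insert x R))) - (\<Sum>v\<in>V. l v * (f (insert v R) - f (insert y R)))
          = (\<Sum>v\<in>V. l v * (- g))"
        unfolding sum_subtractf[symmetric] by (intro sum.cong refl) (simp add: g_def algebra_simps)
      then show ?thesis by (simp only: A_def sum_distrib_right[symmetric])
    qed
    have e2: "l y * (f (insert y R) - f (insert x R)) - l x * (f (insert x R) - f (insert y R)) = - (l x + l y) * g"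
      by (simp add: g_def algebra_simps)
    \<comment> \<open>When both copies jump they meet in \<open>\<tau>\<close>. The excess rate
      \<open>mx - mn\<close> moves only one of them to \<open>\<tau>\<close>, which differs from the
      other copy by a single exchange.\<close>
    have e3: "(\<Sum>z\<in>R. l y * (f (insert x (insert y (R - {z}))) - f (insert x R)))
        - (\<Sum>z\<in>R. l x * (f (insert y (insert x (R - {z}))) - f (insert y R))) \<le> \<rho> * (- mx * g + (mx - mn) * c)"
    proof -
      have "l y * (f (insert x (insert y (R - {z}))) - f (insert x R))
          - l x * (f (insert y (insert x (R - {z}))) - f (insert y R)) \<le> - mx * g + (mx - mn) * c" if z: "z \<in> R" for z
      proof -
        define \<tau> where "\<tau> = insert x (insert y (R - {z}))"
        have t1: "f \<tau> - f (insert y R) \<le> c"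
        proof -
          have "card (insert y (R - {z})) = card R" using finR z xR by (intro card_exchange)
          moreover have "insert y R = insert z (insert y (R - {z}))" using z by auto
          moreover have "insert y (R - {z}) \<subseteq> \<Lambda> - {x, z}" using R xy z xR by auto
          moreover have "z \<in> \<Lambda>" "x \<noteq> z" using R z xR by auto
          ultimately show ?thesis using lip xy cR unfolding swap_lipschitz_def \<tau>_def by (smt (verit))
        qed
        have t2: "f (insert x R) - f \<tau> \<le> c"
        proof -
          have "card (insert x (R - {z})) = card R" using finR z xR by (intro card_exchange)
          moreover have "insert x R = insert z (insert x (R - {z}))" "\<tau> = insert y (insert x (R - {z}))"
            using z by (auto simp: \<tau>_def)
          moreover have "insert x (R - {z}) \<subseteq> \<Lambda> - {z, y}" using R xy z xR by auto
          moreover have "z \<in> \<Lambda>" "y \<noteq> z" using R z xR by auto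
          ultimately show ?thesis using lip xy cR unfolding swap_lipschitz_def by (smt (verit))
        qed
        have "l y * (f \<tau> - f (insert x R)) - l x * (f \<tau> - f (insert y R)) \<le> - mx * g + (mx - mn) * c"
        proof (cases "l x \<le> l y")
          case True
          have "(l y - l x) * (f \<tau> - f (insert y R)) \<le> (l y - l x) * c"
            using t1 True by (intro mult_left_mono) auto
          then show ?thesis using True by (simp add: mx_def mn_def max_def min_def g_def algebra_simps)
        next
          case False
          have "(l x - l y) * (f (insert x R) - f \<tau>) \<le> (l x - l y) * c"
            using t2 False by (intro mult_left_mono) auto
          then show ?thesis using False by (simp add: mx_def mn_def max_def min_def g_def algebra_simps)
        qed
        then show ?thesis by (simp add: \<tau>_def insert_commute)
      qed
      then show ?thesis
        unfolding sum_subtractf[symmetric] \<rho>_def by (intro sum_bounded_above) auto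
    qed
    have e4: "(\<Sum>z\<in>R. \<Sum>v\<in>V. l v * (f (insert x (insert v (R - {z}))) - f (insert x R)))
        - (\<Sum>z\<in>R. \<Sum>v\<in>V. l v * (f (insert y (insert v (R - {z}))) - f (insert y R))) \<le> \<rho> * (A * c - A * g)"
    proof -
      have "(\<Sum>v\<in>V. l v * (f (insert x (insert v (R - {z}))) - f (insert x R)))
          - (\<Sum>v\<in>V. l v * (f (insert y (insert v (R - {z}))) - f (insert y R))) \<le> A * c - A * g" if z: "z \<in> R" for z
      proof -
        have "l v * (f (insert x (insert v (R - {z}))) - f (insert x R))
            - l v * (f (insert y (insert v (R - {z}))) - f (insert y R)) \<le> l v * (c - g)" if v: "v \<in> V" for v
        proof -
          have vR: "v \<notin> R" "v \<in> \<Lambda>" "v \<noteq> x" "v \<noteq> y" using v by (auto simp: V_def)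
          have "card (insert v (R - {z})) = card R" using finR z vR by (intro card_exchange)
          moreover have "insert v (R - {z}) \<subseteq> \<Lambda> - {x, y}" using R vR by auto
          ultimately have "f (insert x (insert v (R - {z}))) - f (insert y (insert v (R - {z}))) \<le> c"
            using lip xy cR unfolding swap_lipschitz_def by (smt (verit))
          from mult_left_mono[OF this less_imp_le[OF lpos[of v]]]
          show ?thesis by (simp add: g_def algebra_simps)
        qed
        then have "(\<Sum>v\<in>V. l v * (f (insert x (insert v (R - {z}))) - f (insert x R))
            - l v * (f (insert y (insert v (R - {z}))) - f (insert y R))) \<le> (\<Sum>v\<in>V. l v * (c - g))"
          by (rule sum_mono)
        also have "(\<Sum>v\<in>V. l v * (c - g)) = A * c - A * g"
          by (simp add: A_def sum_distrib_right right_diff_distrib sum_subtractf)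
        finally show ?thesis unfolding sum_subtractf .
      qed
      then show ?thesis
        unfolding sum_subtractf[symmetric] \<rho>_def by (intro sum_bounded_above) auto
    qed
    have R': "R \<subseteq> \<Lambda> - {y, x}" and V': "\<Lambda> - R - {y, x} = V" using R by (auto simp: V_def)
    have diff: "hop_sum \<Lambda> l f (insert x R) - hop_sum \<Lambda> l f (insert y R)
        \<le> - A * g - (l x + l y) * g + \<rho> * (- mx * g + (mx - mn) * c) + \<rho> * (A * c - A * g)"
      using e1 e2 e3 e4 hop_sum_insert[OF fin R xy, of l f]
        hop_sum_insert[OF fin R' xy(2,1) xy(3)[symmetric], of l f]
      unfolding V' V_def[symmetric] by linarith
    \<comment> \<open>\<open>B\<close> collects the rates multiplying \<open>- g\<close>. The
      condition \<open>e * B \<le> 1\<close> keeps the coefficient of \<open>g\<close> nonnegative,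
      so that \<open>g\<close> may be replaced by \<open>c\<close>.\<close>
    define B where "B = A + (l x + l y) + \<rho> * mx + \<rho> * A"
    have eB: "e * B \<le> 1"
    proof -
      have "\<rho> * mx \<le> \<rho> * M" "\<rho> * A \<le> \<rho> * (\<nu> * M)"
        using A l by (auto intro!: mult_left_mono simp: mx_def \<rho>_def)
      then have "B \<le> \<nu> * M + 2 * M + \<rho> * M + \<rho> * (\<nu> * M)"
        using A l(2)[of x] l(2)[of y] by (simp add: B_def)
      also have "\<dots> = (\<nu> + 2 + \<rho> + \<rho> * \<nu>) * M" by (simp add: algebra_simps)
      also have "\<dots> \<le> ?n ^ 2 * M"
      proof (rule mult_right_mono)
        have "0 \<le> \<rho>" "0 \<le> \<nu>" by (auto simp: \<rho>_def \<nu>_def)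
        then show "\<nu> + 2 + \<rho> + \<rho> * \<nu> \<le> ?n ^ 2"
          unfolding n by (simp add: power2_eq_square algebra_simps)
      qed (use M in auto)
      finally have "e * B \<le> e * (?n ^ 2 * M)" using e(1) by (intro mult_left_mono) auto
      then show ?thesis using e(2) by linarith
    qed
    have "?P (insert x R) - ?P (insert y R) = g + e * (hop_sum \<Lambda> l f (insert x R) - hop_sum \<Lambda> l f (insert y R))"
      by (simp add: g_def algebra_simps)
    also have "\<dots> \<le> g + e * (- A * g - (l x + l y) * g + \<rho> * (- mx * g + (mx - mn) * c) + \<rho> * (A * c - A * g))"
      using diff e(1) by simp
    also have "\<dots> = (1 - e * B) * g + e * (\<rho> * (mx - mn) + \<rho> * A) * c"
      by (simp add: B_def algebra_simps)
    also have "\<dots> \<le> (1 - e * B) * c + e * (\<rho> * (mx - mn) + \<rho> * A) * c"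
      using eB gc by (intro add_right_mono mult_left_mono) auto
    \<comment> \<open>What remains after cancellation is the rate at which the two copies
      meet.\<close>
    also have "\<dots> = (1 - e * (A + (l x + l y) + \<rho> * mn)) * c"
      by (simp add: B_def algebra_simps)
    also have "\<dots> \<le> (1 - e * (?n / M)) * c"
    proof -
      \<comment> \<open>Each site of \<open>\<Lambda>\<close> contributes at least
        \<open>1 / M\<close>: the common holes through \<open>A\<close>, the two discrepant sites
        directly, the common particles through \<open>\<rho> * mn\<close>.\<close>
      have "\<rho> * (1 / M) \<le> \<rho> * mn" using l by (intro mult_left_mono) (auto simp: mn_def \<rho>_def)
      then have "?n / M \<le> A + (l x + l y) + \<rho> * mn"
        using A(1) l(1)[of x] l(1)[of y] unfolding n by (simp add: add_divide_distrib)
      then have "e * (?n / M) \<le> e * (A + (l x + l y) + \<rho> * mn)"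
        using e(1) by (intro mult_left_mono) auto
      then show ?thesis using c0 by (intro mult_right_mono) auto
    qed
    finally show ?thesis .
  qed
  show ?thesis
    unfolding swap_lipschitz_def
  proof (intro ballI allI impI)
    fix x y R assume a: "x \<in> \<Lambda>" "y \<in> \<Lambda>" "x \<noteq> y" "R \<subseteq> \<Lambda> - {x, y}" "Suc (card R) = N"
    then have "R \<subseteq> \<Lambda> - {y, x}" by auto
    then show "\<bar>?P (insert x R) - ?P (insert y R)\<bar> \<le> (1 - e * (?n / M)) * c"
      using one_sided[OF a] one_sided[OF a(2,1) a(3)[symmetric] _ a(5)] by (simp add: abs_le_iff)
  qed
qed

text \<open>Trading one site of \<open>S - T\<close> for one of \<open>T - S\<close> at a time; this
  turns the seminorm into a bound on the oscillation.\<close>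

lemma swap_lipschitz_diff_le:
  assumes fin: "finite \<Lambda>" and lip: "swap_lipschitz \<Lambda> N f c"
    and "S \<subseteq> \<Lambda>" "card S = N" "T \<subseteq> \<Lambda>" "card T = N"
  shows "\<bar>f S - f T\<bar> \<le> real (card (S - T)) * c"
  using assms(3,4)
proof (induction "card (S - T)" arbitrary: S)
  case 0
  have "finite S" "finite T" using 0 assms fin finite_subset by auto
  then have "S \<subseteq> T" using 0 by auto
  then have "S = T" using \<open>finite T\<close> 0 assms by (intro card_subset_eq) auto
  then show ?case by simp
next
  case (Suc k)
  have fS: "finite S" "finite T" using Suc assms fin finite_subset by auto
  have ST: "S - T \<noteq> {}" using Suc.hyps(2) by (metis card.empty nat.distinct(1))
  have "T - S \<noteq> {}"
  proof
    assume "T - S = {}"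
    then have "T = S" using fS Suc.prems assms by (intro card_subset_eq) auto
    then show False using ST by simp
  qed
  then obtain x y where x: "x \<in> S" "x \<notin> T" and y: "y \<in> T" "y \<notin> S" using ST by blast
  define S' where "S' = insert y (S - {x})"
  have "S' - T = (S - T) - {x}" using y by (auto simp: S'_def)
  then have k: "k = card (S' - T)" using Suc.hyps(2) x fS by simp
  have S': "S' \<subseteq> \<Lambda>" "card S' = N"
    using Suc.prems x y assms fS card_exchange[of S x y] by (auto simp: S'_def)
  have IH: "\<bar>f S' - f T\<bar> \<le> real k * c" using Suc.hyps(1)[OF k S'] k by simp
  have "\<bar>f (insert x (S - {x})) - f (insert y (S - {x}))\<bar> \<le> c"
  proof -
    have "Suc (card (S - {x})) = N" using Suc.prems x fS by (metis card_Suc_Diff1)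
    moreover have "S - {x} \<subseteq> \<Lambda> - {x, y}" "x \<in> \<Lambda>" "y \<in> \<Lambda>" "x \<noteq> y" using Suc.prems x y assms by auto
    ultimately show ?thesis using lip unfolding swap_lipschitz_def by blast
  qed
  then have "\<bar>f S - f S'\<bar> \<le> c" using x by (simp add: insert_absorb S'_def)
  with IH have "\<bar>f S - f T\<bar> \<le> real (Suc k) * c" by (simp add: algebra_simps)
  then show ?case unfolding Suc.hyps(2)[symmetric] .
qed

text \<open>Iterating one small time step \<open>P\<close> contracts the seminorm geometrically, so
  mean-zero functions decay, and self-adjointness carries the rate over to the quadratic form. In
  the constant, one \<open>M\<close> comes from the rate \<open>card \<Lambda> / M\<close>, two from
  \<open>l x * l y \<le> M * M\<close>, and the one half from the Dirichlet form.\<close>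

lemma Bernoulli_Laplace_gap:
  fixes l :: "'v \<Rightarrow> real"
  assumes fin: "finite \<Lambda>" and M: "M \<ge> 1" and l: "\<And>z. 1 / M \<le> l z" "\<And>z. l z \<le> M"
    and mean: "(\<Sum>S\<in>{S. S \<subseteq> \<Lambda> \<and> card S = N}. prod l S * f S) = 0"
  shows "real (card \<Lambda>) * (\<Sum>S\<in>{S. S \<subseteq> \<Lambda> \<and> card S = N}. prod l S * (f S)\<^sup>2)
    \<le> M ^ 3 / 2 * (\<Sum>x\<in>\<Lambda>. \<Sum>y\<in>\<Lambda> - {x}. \<Sum>R\<in>{R. R \<subseteq> \<Lambda> - {x, y} \<and> Suc (card R) = N}.
        prod l R * (f (insert y R) - f (insert x R))\<^sup>2)"
proof (cases "card \<Lambda> = 0")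
  case True
  then show ?thesis using fin by simp
next
  case False
  let ?X = "{S. S \<subseteq> \<Lambda> \<and> card S = N}"
  let ?n = "real (card \<Lambda>)"
  have lpos: "l z > 0" for z using l(1)[of z] M by (smt (verit) zero_less_divide_1_iff)
  have wpos: "prod l S > 0" for S by (rule prod_pos) (simp add: lpos)
  have finX: "finite ?X" using fin by simp
  have n: "?n \<ge> 1" using False by simp
  define e where "e = 1 / (2 * (?n ^ 2 * M))"
  have nM: "?n ^ 2 * M > 0" using n M by (intro mult_pos_pos) auto
  have e: "e > 0" "e * (?n ^ 2 * M) \<le> 1" using n M by (auto simp: e_def)
  define r where "r = 1 - e * (?n / M)"
  have r: "r > 0"
  proof -
    have "?n / M \<le> ?n ^ 2 * M"
    proof -
      have "?n / M \<le> ?n / 1" using M by (intro divide_left_mono) auto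
      also have "\<dots> \<le> ?n * ?n * 1" using n by simp
      also have "\<dots> \<le> ?n * ?n * M" using M by (intro mult_left_mono) auto
      finally show ?thesis by (simp add: power2_eq_square)
    qed
    then have "e * (?n / M) \<le> e * (?n ^ 2 * M)" using e by (intro mult_left_mono) auto
    also have "\<dots> = 1 / 2" using n M by (simp add: e_def)
    finally show ?thesis unfolding r_def by linarith
  qed
  define P where "P = (\<lambda>f S. f S + e * hop_sum \<Lambda> l f S)"
  have sa: "(\<Sum>S\<in>?X. prod l S * (f S * P g S)) = (\<Sum>S\<in>?X. prod l S * (P f S * g S))" for f g
  proof -
    have "(\<Sum>S\<in>?X. prod l S * (f S * hop_sum \<Lambda> l g S)) = (\<Sum>S\<in>?X. prod l S * (g S * hop_sum \<Lambda> l f S))"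
      unfolding hop_sum_Dirichlet_form[OF fin] by (simp add: mult.commute)
    then have "e * (\<Sum>S\<in>?X. prod l S * (f S * hop_sum \<Lambda> l g S)) = e * (\<Sum>S\<in>?X. prod l S * (g S * hop_sum \<Lambda> l f S))"
      by simp
    then show ?thesis
      by (simp add: P_def sum_distrib_left sum.distrib algebra_simps)
  qed
  have mean_P: "(\<Sum>S\<in>?X. prod l S * P f S) = (\<Sum>S\<in>?X. prod l S * f S)" for f
  proof -
    have "(\<Sum>S\<in>?X. prod l S * hop_sum \<Lambda> l f S) = 0"
      using hop_sum_Dirichlet_form[OF fin, where g = "\<lambda>_. 1" and l = l and f = f and N = N] by simp
    moreover have "(\<Sum>S\<in>?X. prod l S * P f S)
        = (\<Sum>S\<in>?X. prod l S * f S) + e * (\<Sum>S\<in>?X. prod l S * hop_sum \<Lambda> l f S)"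
      by (simp add: P_def sum_distrib_left sum.distrib algebra_simps)
    ultimately show ?thesis by simp
  qed
  \<comment> \<open>A crude initial Lipschitz constant: only the rate \<open>r\<close> counts, since
    the log-convexity argument discards the prefactor.\<close>
  define c where "c = 2 * (\<Sum>S\<in>Pow \<Lambda>. \<bar>f S\<bar>)"
  have iter: "swap_lipschitz \<Lambda> N ((P ^^ k) f) (r ^ k * c) \<and> (\<Sum>S\<in>?X. prod l S * (P ^^ k) f S) = 0" for k
  proof (induction k)
    case 0
    have "\<bar>f S\<bar> \<le> c / 2" if "S \<subseteq> \<Lambda>" for S
      using member_le_sum[of S "Pow \<Lambda>" "\<lambda>S. \<bar>f S\<bar>"] that fin by (simp add: c_def)
    then have "\<bar>f (insert x R) - f (insert y R)\<bar> \<le> c" if "x \<in> \<Lambda>" "y \<in> \<Lambda>" "R \<subseteq> \<Lambda> - {x, y}" for x y R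
    proof -
      have "insert x R \<subseteq> \<Lambda>" "insert y R \<subseteq> \<Lambda>" using that by auto
      then show ?thesis using \<open>\<And>S. S \<subseteq> \<Lambda> \<Longrightarrow> \<bar>f S\<bar> \<le> c / 2\<close> by (smt (verit) field_sum_of_halves)
    qed
    then show ?case using mean by (simp add: swap_lipschitz_def)
  next
    case (Suc k)
    have "swap_lipschitz \<Lambda> N (P g) (r * (r ^ k * c))" if "swap_lipschitz \<Lambda> N g (r ^ k * c)" for g
      unfolding P_def r_def[symmetric] using swap_lipschitz_hop_sum[OF fin M l e that] by (simp only: r_def)
    with Suc show ?case using mean_P[of "(P ^^ k) f"] by (simp add: mult.assoc)
  qed
  define W where "W = (\<Sum>S\<in>?X. prod l S)"
  have decay: "(\<Sum>S\<in>?X. prod l S * ((P ^^ k) f S)\<^sup>2) \<le> (W * (real N * c)\<^sup>2) * r ^ (2 * k)" for k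
  proof -
    define g where "g = (P ^^ k) f"
    have g: "swap_lipschitz \<Lambda> N g (r ^ k * c)" "(\<Sum>S\<in>?X. prod l S * g S) = 0"
      using iter[of k] by (auto simp: g_def)
    have c0: "r ^ k * c \<ge> 0" using r by (simp add: c_def sum_nonneg)
    have bound: "\<bar>g S\<bar> \<le> real N * (r ^ k * c)" if S: "S \<in> ?X" for S
    proof -
      have Wpos: "W > 0" unfolding W_def using finX S wpos by (intro sum_pos) auto
      have osc: "\<bar>g S - g T\<bar> \<le> real N * (r ^ k * c)" if T: "T \<in> ?X" for T
      proof -
        have "card (S - T) \<le> N" using S fin finite_subset by (auto intro!: card_mono)
        then have "real (card (S - T)) * (r ^ k * c) \<le> real N * (r ^ k * c)"
          using c0 by (intro mult_right_mono) auto
        then show ?thesis using swap_lipschitz_diff_le[OF fin g(1), of S T] S T by auto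
      qed
      \<comment> \<open>By the zero mean, \<open>g S\<close> is a weighted average of its
        differences from all values of \<open>g\<close>, so the oscillation bounds its size.\<close>
      have "W * g S = (\<Sum>T\<in>?X. prod l T * (g S - g T))"
        using g(2) by (simp add: W_def sum_distrib_right right_diff_distrib sum_subtractf)
      then have "\<bar>W * g S\<bar> \<le> (\<Sum>T\<in>?X. \<bar>prod l T * (g S - g T)\<bar>)" by simp
      also have "\<dots> \<le> (\<Sum>T\<in>?X. prod l T * (real N * (r ^ k * c)))"
        using osc wpos by (intro sum_mono) (auto simp: abs_mult less_imp_le abs_of_pos intro!: mult_left_mono)
      also have "\<dots> = W * (real N * (r ^ k * c))" by (simp add: W_def sum_distrib_right)
      finally show ?thesis using Wpos by (simp add: abs_mult)
    qed
    have "(\<Sum>S\<in>?X. prod l S * (g S)\<^sup>2) \<le> (\<Sum>S\<in>?X. prod l S * (real N * (r ^ k * c))\<^sup>2)"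
    proof (intro sum_mono mult_left_mono less_imp_le[OF wpos])
      fix S assume "S \<in> ?X"
      then show "(g S)\<^sup>2 \<le> (real N * (r ^ k * c))\<^sup>2"
        using power_mono[OF bound, of S 2] by simp
    qed
    also have "\<dots> = (W * (real N * c)\<^sup>2) * r ^ (2 * k)"
    proof -
      have "(real N * (r ^ k * c))\<^sup>2 = (real N * c)\<^sup>2 * r ^ (2 * k)"
        unfolding power_even_eq by (simp add: power_mult_distrib)
      then show ?thesis by (simp only: W_def sum_distrib_right[symmetric] mult.assoc)
    qed
    finally show ?thesis by (simp add: g_def)
  qed
  define E where "E = (\<Sum>S\<in>?X. prod l S * (f S)\<^sup>2)"
  define D where "D = (\<Sum>x\<in>\<Lambda>. \<Sum>y\<in>\<Lambda> - {x}. \<Sum>R\<in>{R. R \<subseteq> \<Lambda> - {x, y} \<and> Suc (card R) = N}.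
        prod l R * l x * l y * ((f (insert y R) - f (insert x R)) * (f (insert y R) - f (insert x R))))"
  have "(\<Sum>S\<in>?X. prod l S * (f S * P f S)) \<le> r * E"
    unfolding E_def
    by (rule selfadjoint_contraction_quadratic_form[OF finX less_imp_le[OF wpos] sa decay r])
  moreover have "(\<Sum>S\<in>?X. prod l S * (f S * P f S)) = E + e * (\<Sum>S\<in>?X. prod l S * (f S * hop_sum \<Lambda> l f S))"
    by (simp add: P_def E_def sum_distrib_left sum.distrib algebra_simps power2_eq_square)
  moreover have "(\<Sum>S\<in>?X. prod l S * (f S * hop_sum \<Lambda> l f S)) = - (1 / 2) * D"
    unfolding D_def by (rule hop_sum_Dirichlet_form[OF fin])
  ultimately have "e * (?n / M * E) \<le> e * (D / 2)" by (simp add: r_def algebra_simps)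
  then have "?n / M * E \<le> D / 2" using e(1) by (rule mult_left_le_imp_le)
  then have "?n * E \<le> M * (D / 2)" using M by (simp add: field_simps)
  also have "D \<le> M\<^sup>2 * (\<Sum>x\<in>\<Lambda>. \<Sum>y\<in>\<Lambda> - {x}. \<Sum>R\<in>{R. R \<subseteq> \<Lambda> - {x, y} \<and> Suc (card R) = N}.
        prod l R * (f (insert y R) - f (insert x R))\<^sup>2)"
    unfolding D_def sum_distrib_left
  proof (intro sum_mono)
    fix x y R
    have "l x * l y \<le> M * M" using l M by (intro mult_mono l less_imp_le[OF lpos]) auto
    then have "l x * l y * (prod l R * (f (insert y R) - f (insert x R))\<^sup>2)
        \<le> M * M * (prod l R * (f (insert y R) - f (insert x R))\<^sup>2)"
      using wpos[of R] by (intro mult_right_mono) auto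
    then show "prod l R * l x * l y * ((f (insert y R) - f (insert x R)) * (f (insert y R) - f (insert x R)))
        \<le> M\<^sup>2 * (prod l R * (f (insert y R) - f (insert x R))\<^sup>2)"
      by (simp add: power2_eq_square mult_ac)
  qed
  finally show ?thesis using M by (simp add: E_def power2_eq_square power3_eq_cube mult_left_mono mult_ac)
qed


section \<open>Paths in a cube\<close>

text \<open>Restoring the weight at \<open>m\<close> and flattening those at \<open>x\<close> and
  \<open>y\<close> loses two factors \<open>M\<close>. This is affordable because it is applied once
  per coordinate, at the corners of a path, and never along it.\<close>

lemma swap_energy_triangle:
  fixes l :: "'v \<Rightarrow> real"
  assumes fin: "finite \<Lambda>" and M: "M \<ge> 1" and l: "\<And>z. 1 / M \<le> l z" "\<And>z. l z \<le> M"
    and xmy: "x \<in> \<Lambda>" "m \<in> \<Lambda>" "y \<in> \<Lambda>"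
  shows "swap_energy \<Lambda> l f x y \<le> 2 * M\<^sup>2 * (swap_energy \<Lambda> l f x m + swap_energy \<Lambda> l f m y)"
proof -
  have lpos: "l z > 0" for z using l(1)[of z] M by (smt (verit) zero_less_divide_1_iff)
  have en0: "swap_energy \<Lambda> l f u v \<ge> 0" for u v by (rule swap_energy_nonneg) (simp add: less_imp_le lpos)
  have M2: "1 \<le> 2 * M\<^sup>2" using one_le_power[OF M, of 2] by simp
  consider "x = y" | "m = x \<or> m = y" | "x \<noteq> y" "x \<noteq> m" "y \<noteq> m" by blast
  then show ?thesis
  proof cases
    case 1
    then show ?thesis using en0 by (simp add: swap_energy_def[of \<Lambda> l f y y])
  next
    case 2
    then have "swap_energy \<Lambda> l f x y \<le> swap_energy \<Lambda> l f x m + swap_energy \<Lambda> l f m y" using en0 by auto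
    also have "\<dots> \<le> 2 * M\<^sup>2 * (swap_energy \<Lambda> l f x m + swap_energy \<Lambda> l f m y)"
      using mult_right_mono[OF M2, of "swap_energy \<Lambda> l f x m + swap_energy \<Lambda> l f m y"] en0 by simp
    finally show ?thesis .
  next
    case 3
    define h :: "'v \<Rightarrow> bool \<Rightarrow> real" where "h = (\<lambda>z s. if s then l z else 1)"
    have E: "two_state_energy \<Lambda> h f u v = swap_energy \<Lambda> l f u v" for u v
      unfolding h_def by (rule two_state_energy_eq_swap_energy[OF fin])
    have h0: "h z s \<ge> 0" and hM: "h z s \<le> M" for z s
      using lpos[of z] l(2)[of z] M by (auto simp: h_def)
    have h1: "1 \<le> M * h z s" for z s
      using mult_left_mono[OF l(1)[of z], of M] M by (auto simp: h_def)
    have up: "two_state_energy \<Lambda> (h(z := \<lambda>_. 1)) f u v \<le> M * swap_energy \<Lambda> l f u v"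
      if "z \<in> \<Lambda>" "z \<noteq> u" "z \<noteq> v" for z u v
      unfolding E[symmetric] by (rule two_state_energy_mono_scale) (use fin that h0 h1 in auto)
    have "swap_energy \<Lambda> l f x y = two_state_energy \<Lambda> ((h(m := \<lambda>_. 1))(m := h m)) f x y"
      by (simp add: E)
    also have "\<dots> \<le> M * two_state_energy \<Lambda> (h(m := \<lambda>_. 1)) f x y"
      by (rule two_state_energy_mono_scale) (use fin xmy 3 h0 hM in auto)
    also have "\<dots> \<le> M * ((1 + 1) * (two_state_energy \<Lambda> (h(y := \<lambda>_. 1)) f x m / 1
        + two_state_energy \<Lambda> (h(x := \<lambda>_. 1)) f m y / 1))"
      using M by (intro mult_left_mono two_state_energy_triangle) (use fin xmy 3 h0 in auto)
    also have "\<dots> \<le> M * ((1 + 1) * ((M * swap_energy \<Lambda> l f x m) / 1 + (M * swap_energy \<Lambda> l f m y) / 1))"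
      using M up[of y x m] up[of x m y] xmy 3 by (intro mult_left_mono add_mono divide_right_mono) auto
    finally show ?thesis by (simp add: power2_eq_square algebra_simps)
  qed
qed

section \<open>Averaging over coordinate-wise paths\<close>

lemma finite_cube: "finite (cube a L)"
proof -
  have "cube a L = Pi\<^sub>E UNIV (\<lambda>i. {a i..<a i + int L})"
    by (auto simp: cube_def PiE_def Pi_def)
  then show ?thesis by (simp add: finite_PiE)
qed

text \<open>A corner of the coordinate-wise path from \<open>x\<close> to \<open>y\<close>: the
  coordinates in \<open>I\<close> have already been changed.\<close>

definition mix :: "'d set \<Rightarrow> ('d \<Rightarrow> int) \<Rightarrow> ('d \<Rightarrow> int) \<Rightarrow> 'd \<Rightarrow> int" where
  "mix I x y = (\<lambda>i. if i \<in> I then y i else x i)"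

lemma mix_in_cube: "x \<in> cube a L \<Longrightarrow> y \<in> cube a L \<Longrightarrow> mix I x y \<in> cube a L"
  by (auto simp: cube_def mix_def)

text \<open>The map from \<open>(x, y)\<close> to \<open>(mix I x y, mix I y x)\<close> is an
  involution, and in the new variables the next leg changes the coordinate \<open>i\<close>
  only.\<close>

lemma mix_mix:
  "mix I (mix I x y) (mix I y x) = x"
  "i \<notin> I \<Longrightarrow> mix {i} (mix I x y) (mix I y x) = mix (insert i I) x y"
  by (auto simp: mix_def)

text \<open>Coordinates are changed one at a time, each corner costing a factor \<open>A\<close>.
  The involution of pairs turns every leg into a change of one coordinate between freely ranging
  sites, so legs are not overcounted.\<close>

lemma sum_mix_le:
  fixes q :: "'d::finite site \<Rightarrow> 'd site \<Rightarrow> real"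
  assumes A: "A \<ge> 1" and q0: "\<And>x y. q x y \<ge> 0" and refl: "\<And>x. q x x = 0"
    and tri: "\<And>x m y. x \<in> cube a L \<Longrightarrow> m \<in> cube a L \<Longrightarrow> y \<in> cube a L \<Longrightarrow> q x y \<le> A * (q x m + q m y)"
  shows "(\<Sum>x\<in>cube a L. \<Sum>y\<in>cube a L. q x (mix I x y))
    \<le> A ^ card I * (\<Sum>i\<in>I. \<Sum>x\<in>cube a L. \<Sum>y\<in>cube a L. q x (mix {i} x y))"
proof (induction I rule: finite_induct[OF finite])
  case 1
  then show ?case by (simp add: mix_def refl)
next
  case (2 i I)
  let ?\<Lambda> = "cube a L"
  define B where "B I = (\<Sum>x\<in>?\<Lambda>. \<Sum>y\<in>?\<Lambda>. q x (mix I x y))" for I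
  have B0: "B J \<ge> 0" for J unfolding B_def by (intro sum_nonneg q0)
  have "B (insert i I) \<le> (\<Sum>x\<in>?\<Lambda>. \<Sum>y\<in>?\<Lambda>. A * (q x (mix I x y) + q (mix I x y) (mix (insert i I) x y)))"
    unfolding B_def by (intro sum_mono tri mix_in_cube)
  also have "\<dots> = A * (B I + (\<Sum>x\<in>?\<Lambda>. \<Sum>y\<in>?\<Lambda>. q (mix I x y) (mix (insert i I) x y)))"
    by (simp add: B_def sum_distrib_left[symmetric] sum.distrib)
  also have "(\<Sum>x\<in>?\<Lambda>. \<Sum>y\<in>?\<Lambda>. q (mix I x y) (mix (insert i I) x y))
      = (\<Sum>(x, y)\<in>?\<Lambda> \<times> ?\<Lambda>. q (mix I x y) (mix (insert i I) x y))"
    by (simp add: sum.cartesian_product)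
  also have "\<dots> = (\<Sum>(x, y)\<in>?\<Lambda> \<times> ?\<Lambda>. q x (mix {i} x y))"
    by (rule sum.reindex_bij_witness[of _ "\<lambda>(x, y). (mix I x y, mix I y x)" "\<lambda>(x, y). (mix I x y, mix I y x)"])
      (use 2 in \<open>auto simp: mix_mix mix_in_cube\<close>)
  also have "\<dots> = B {i}" by (simp add: B_def sum.cartesian_product)
  also have "A * (B I + B {i}) \<le> A * (A ^ card I * (\<Sum>j\<in>I. B {j}) + A ^ card I * B {i})"
  proof (intro mult_left_mono add_mono)
    show "B I \<le> A ^ card I * (\<Sum>j\<in>I. B {j})" using 2 by (simp add: B_def)
    show "B {i} \<le> A ^ card I * B {i}"
      using mult_right_mono[OF one_le_power[OF A, of "card I"] B0[of "{i}"]] by simp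
  qed (use A in auto)
  also have "\<dots> = A ^ card (insert i I) * (\<Sum>j\<in>insert i I. B {j})"
    using 2 by (simp add: algebra_simps)
  finally show ?case by (simp add: B_def)
qed

text \<open>Exchanging \<open>t\<close> with the coordinate \<open>x i\<close> is a bijection: an
  edge in direction \<open>i\<close> is met once for each of the \<open>L\<close> sites on its
  line.\<close>

lemma sum_line_shift_le:
  fixes g :: "'d::finite site \<Rightarrow> real"
  assumes g0: "\<And>x. g x \<ge> 0"
  shows "(\<Sum>x\<in>cube a L. \<Sum>t\<in>{a i..<a i + int L - 1}. g (x(i := t)))
    \<le> real L * (\<Sum>x\<in>{x \<in> cube a L. x i + 1 < a i + int L}. g x)"
proof -
  let ?T = "{a i..<a i + int L - 1}" and ?S = "{a i..<a i + int L}"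
  let ?\<Lambda>' = "{x \<in> cube a L. x i + 1 < a i + int L}"
  have "(\<Sum>x\<in>cube a L. \<Sum>t\<in>?T. g (x(i := t))) = (\<Sum>(x, t)\<in>cube a L \<times> ?T. g (x(i := t)))"
    by (simp add: sum.cartesian_product)
  also have "\<dots> = (\<Sum>(x, s)\<in>?\<Lambda>' \<times> ?S. g x)"
    by (rule sum.reindex_bij_witness[of _ "\<lambda>(x, s). (x(i := s), x i)" "\<lambda>(x, t). (x(i := t), x i)"])
      (auto simp: cube_def)
  also have "\<dots> = (\<Sum>x\<in>?\<Lambda>'. \<Sum>s\<in>?S. g x)" by (rule sum.cartesian_product[symmetric])
  also have "\<dots> = real L * (\<Sum>x\<in>?\<Lambda>'. g x)" by (simp add: sum_distrib_left)
  finally show ?thesis by simp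
qed

lemma adjacent_upd: "adjacent (x :: 'd::finite site) (x(i := x i + 1))"
proof -
  have "(\<Sum>j\<in>UNIV. (x j - (x(i := x i + 1)) j)\<^sup>2) = (\<Sum>j\<in>UNIV. if j = i then 1 else 0)"
    by (intro sum.cong refl) auto
  then show ?thesis by (simp add: adjacent_def)
qed

abbreviation adjacent_pairs :: "'d::finite site set \<Rightarrow> ('d site \<times> 'd site) set" where
  "adjacent_pairs \<Lambda> \<equiv> {(x, y). x \<in> \<Lambda> \<and> y \<in> \<Lambda> \<and> adjacent x y}"

lemma finite_adjacent_pairs: "finite \<Lambda> \<Longrightarrow> finite (adjacent_pairs \<Lambda>)"
  by (rule finite_subset[of _ "\<Lambda> \<times> \<Lambda>"]) auto

text \<open>Unit steps in positive directions are distinct ordered pairs, so no adjacent pair is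
  used twice.\<close>

lemma sum_directions_le_adjacent_pairs:
  fixes q :: "'d::finite site \<Rightarrow> 'd site \<Rightarrow> real"
  assumes q0: "\<And>x y. q x y \<ge> 0"
  shows "(\<Sum>i\<in>UNIV. \<Sum>x\<in>{x \<in> cube a L. x i + 1 < a i + int L}. q x (x(i := x i + 1)))
    \<le> (\<Sum>(x, y)\<in>adjacent_pairs (cube a L). q x y)"
proof -
  let ?S = "SIGMA i:UNIV. {x \<in> cube a L. x i + 1 < a i + int L}"
  let ?e = "\<lambda>(i, x). (x, x(i := x i + 1)) :: 'd site \<times> 'd site"
  have "i = j" if "x(i := x i + 1) = x(j := x j + 1)" for i j and x :: "'d site"
    using fun_cong[OF that, of i] by (auto split: if_splits)
  then have "inj_on ?e ?S" by (auto simp: inj_on_def)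
  then have "(\<Sum>(i, x)\<in>?S. q x (x(i := x i + 1))) = (\<Sum>(x, y)\<in>?e ` ?S. q x y)"
    by (simp add: sum.reindex case_prod_unfold)
  also have "\<dots> \<le> (\<Sum>(x, y)\<in>adjacent_pairs (cube a L). q x y)"
  proof (rule sum_mono2)
    have "x(i := x i + 1) \<in> cube a L" if "x \<in> cube a L" "x i + 1 < a i + int L" for x i
    proof -
      have "a i \<le> x i + 1" using that(1) unfolding cube_def by (smt (verit) mem_Collect_eq)
      then show ?thesis using that by (auto simp: cube_def)
    qed
    then show "?e ` ?S \<subseteq> adjacent_pairs (cube a L)" by (auto simp: adjacent_upd)
  qed (auto simp: q0 finite_adjacent_pairs finite_cube)
  finally show ?thesis by (subst sum.Sigma) (auto simp: finite_cube)
qed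

lemma cube_swap_energy_comparison:
  fixes M :: real
  assumes M: "M \<ge> 1"
  obtains C :: real where "C \<ge> 0"
    "\<And>(a :: 'd::finite site) L (l :: 'd site \<Rightarrow> real) f. (\<And>z. 1 / M \<le> l z) \<Longrightarrow> (\<And>z. l z \<le> M) \<Longrightarrow>
       (\<Sum>x\<in>cube a L. \<Sum>y\<in>cube a L. swap_energy (cube a L) l f x y)
       \<le> C * (real L)\<^sup>2 * real (card (cube a L)) *
          (\<Sum>(x, y)\<in>adjacent_pairs (cube a L). swap_energy (cube a L) l f x y)"
proof (rule moving_particle[OF M, where 'v = "'d site"])
  fix C1 assume C1: "C1 \<ge> 0"
    and mv: "\<And>(\<Lambda> :: 'd site set) (l :: 'd site \<Rightarrow> real) f (p :: nat \<Rightarrow> 'd site) n. finite \<Lambda> \<Longrightarrow> inj_on p {..n} \<Longrightarrow>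
       p ` {..n} \<subseteq> \<Lambda> \<Longrightarrow> (\<And>z. 1 / M \<le> l z) \<Longrightarrow> (\<And>z. l z \<le> M) \<Longrightarrow>
       swap_energy \<Lambda> l f (p 0) (p n) \<le> C1 * real n * (\<Sum>j<n. swap_energy \<Lambda> l f (p j) (p (Suc j)))"
  define A where "A = 2 * M\<^sup>2"
  have A: "A \<ge> 1" using one_le_power[OF M, of 2] by (simp add: A_def)
  show thesis
  proof (rule that)
    show "A ^ card (UNIV :: 'd set) * C1 \<ge> 0" using A C1 by simp
  next
    fix a :: "'d site" and L and l :: "'d site \<Rightarrow> real" and f
    assume l: "\<And>z. 1 / M \<le> l z" "\<And>z. l z \<le> M"
    let ?\<Lambda> = "cube a L"
    define q where "q = swap_energy ?\<Lambda> l f"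
    have lpos: "l z > 0" for z using l(1)[of z] M by (smt (verit) zero_less_divide_1_iff)
    have q0: "q x y \<ge> 0" for x y unfolding q_def by (rule swap_energy_nonneg) (simp add: less_imp_le lpos)
    have ordered: "q (z(i := u)) (z(i := v)) \<le> C1 * real L * (\<Sum>t\<in>{a i..<a i + int L - 1}. q (z(i := t)) (z(i := t + 1)))"
      if z: "z \<in> ?\<Lambda>" and uv: "a i \<le> u" "u \<le> v" "v < a i + int L" for z i u v
    proof -
      define n where "n = nat (v - u)"
      define p where "p j = z(i := u + int j)" for j
      have "inj_on p {..n}" by (rule inj_onI) (metis add_left_cancel fun_upd_same of_nat_eq_iff p_def)
      moreover have "p ` {..n} \<subseteq> ?\<Lambda>" using z uv by (auto simp: p_def cube_def n_def)
      ultimately have "q (p 0) (p n) \<le> C1 * real n * (\<Sum>j<n. q (p j) (p (Suc j)))"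
        unfolding q_def by (intro mv finite_cube l)
      also have "(\<Sum>j<n. q (p j) (p (Suc j))) = (\<Sum>t\<in>{u..<v}. q (z(i := t)) (z(i := t + 1)))"
        by (rule sum.reindex_bij_witness[of _ "\<lambda>t. nat (t - u)" "\<lambda>j. u + int j"])
          (use uv in \<open>auto simp: p_def n_def add_ac\<close>)
      also have "C1 * real n * (\<Sum>t\<in>{u..<v}. q (z(i := t)) (z(i := t + 1)))
          \<le> C1 * real L * (\<Sum>t\<in>{a i..<a i + int L - 1}. q (z(i := t)) (z(i := t + 1)))"
        using C1 uv by (intro mult_mono sum_mono2) (auto simp: q0 n_def sum_nonneg)
      finally have "q (p 0) (p n) \<le> C1 * real L * (\<Sum>t\<in>{a i..<a i + int L - 1}. q (z(i := t)) (z(i := t + 1)))" .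
      moreover have "p 0 = z(i := u)" "p n = z(i := v)" using uv by (simp_all add: p_def n_def)
      ultimately show ?thesis by (simp only:)
    qed
    have line: "q x (mix {i} x y) \<le> C1 * real L * (\<Sum>t\<in>{a i..<a i + int L - 1}. q (x(i := t)) (x(i := t + 1)))"
      if xy: "x \<in> ?\<Lambda>" "y \<in> ?\<Lambda>" for x y i
    proof -
      have m: "mix {i} x y = x(i := y i)" by (auto simp: mix_def)
      have b: "a i \<le> x i" "x i < a i + int L" "a i \<le> y i" "y i < a i + int L" using xy by (auto simp: cube_def)
      show ?thesis
      proof (cases "x i \<le> y i")
        case True
        then show ?thesis using ordered[OF xy(1), of i "x i" "y i"] b m by simp
      next
        \<comment> \<open>The path is taken in increasing direction and read backwards, swap
          energies being symmetric.\<close>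
        case False
        then have "q (x(i := y i)) (x(i := x i)) \<le> C1 * real L * (\<Sum>t\<in>{a i..<a i + int L - 1}. q (x(i := t)) (x(i := t + 1)))"
          using ordered[OF xy(1), of i "y i" "x i"] b by simp
        then show ?thesis unfolding m q_def by (simp add: swap_energy_commute[of _ _ _ x])
      qed
    qed
    define Ei where "Ei i = (\<Sum>x\<in>{x \<in> ?\<Lambda>. x i + 1 < a i + int L}. q x (x(i := x i + 1)))" for i
    have B: "(\<Sum>x\<in>?\<Lambda>. \<Sum>y\<in>?\<Lambda>. q x (mix {i} x y)) \<le> C1 * (real L)\<^sup>2 * real (card ?\<Lambda>) * Ei i" for i
    proof -
      have "(\<Sum>x\<in>?\<Lambda>. \<Sum>y\<in>?\<Lambda>. q x (mix {i} x y))
          \<le> (\<Sum>x\<in>?\<Lambda>. \<Sum>y\<in>?\<Lambda>. C1 * real L * (\<Sum>t\<in>{a i..<a i + int L - 1}. q (x(i := t)) (x(i := t + 1))))"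
        by (intro sum_mono line)
      \<comment> \<open>The bound for a whole line no longer depends on \<open>y\<close>, whose
        summation yields the volume factor.\<close>
      also have "\<dots> = real (card ?\<Lambda>) * (C1 * real L * (\<Sum>x\<in>?\<Lambda>. \<Sum>t\<in>{a i..<a i + int L - 1}. q (x(i := t)) (x(i := t + 1))))"
        by (simp add: sum_distrib_left)
      also have "\<dots> \<le> real (card ?\<Lambda>) * (C1 * real L * (real L * Ei i))"
        using sum_line_shift_le[where g = "\<lambda>x. q x (x(i := x i + 1))" and a = a and L = L and i = i] C1 q0
        by (intro mult_left_mono) (auto simp: Ei_def)
      finally show ?thesis by (simp add: power2_eq_square mult_ac)
    qed
    have "(\<Sum>x\<in>?\<Lambda>. \<Sum>y\<in>?\<Lambda>. q x y) = (\<Sum>x\<in>?\<Lambda>. \<Sum>y\<in>?\<Lambda>. q x (mix UNIV x y))" by (simp add: mix_def)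
    also have "\<dots> \<le> A ^ card (UNIV :: 'd set) * (\<Sum>i\<in>UNIV. \<Sum>x\<in>?\<Lambda>. \<Sum>y\<in>?\<Lambda>. q x (mix {i} x y))"
    proof (rule sum_mix_le[OF A q0])
      show "q x x = 0" for x by (simp add: q_def swap_energy_def)
      show "q x y \<le> A * (q x m + q m y)" if "x \<in> ?\<Lambda>" "m \<in> ?\<Lambda>" "y \<in> ?\<Lambda>" for x m y
        unfolding q_def A_def by (rule swap_energy_triangle[OF finite_cube M l that])
    qed
    also have "\<dots> \<le> A ^ card (UNIV :: 'd set) * (\<Sum>i\<in>UNIV. C1 * (real L)\<^sup>2 * real (card ?\<Lambda>) * Ei i)"
      using A by (intro mult_left_mono sum_mono B) auto
    also have "\<dots> = A ^ card (UNIV :: 'd set) * C1 * (real L)\<^sup>2 * real (card ?\<Lambda>) * (\<Sum>i\<in>UNIV. Ei i)"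
      by (simp only: sum_distrib_left[symmetric] mult.assoc)
    also have "\<dots> \<le> A ^ card (UNIV :: 'd set) * C1 * (real L)\<^sup>2 * real (card ?\<Lambda>) * (\<Sum>(x, y)\<in>adjacent_pairs ?\<Lambda>. q x y)"
      unfolding Ei_def using A C1 by (intro mult_left_mono sum_directions_le_adjacent_pairs q0) auto
    finally show "(\<Sum>x\<in>?\<Lambda>. \<Sum>y\<in>?\<Lambda>. swap_energy ?\<Lambda> l f x y)
       \<le> A ^ card (UNIV :: 'd set) * C1 * (real L)\<^sup>2 * real (card ?\<Lambda>) *
          (\<Sum>(x, y)\<in>adjacent_pairs ?\<Lambda>. swap_energy ?\<Lambda> l f x y)"
      by (simp add: q_def)
  qed
qed


section \<open>From sets to configurations\<close>

definition occ :: "'v set \<Rightarrow> 'v \<Rightarrow> nat" where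
  "occ S = (\<lambda>x. if x \<in> S then 1 else 0)"

lemma inj_occ: "inj occ"
proof (rule injI)
  fix S T :: "'v set" assume "occ S = occ T"
  then have "x \<in> S \<longleftrightarrow> x \<in> T" for x by (auto simp: occ_def fun_eq_iff split: if_splits)
  then show "S = T" by blast
qed

lemma configs_eq:
  assumes fin: "finite \<Lambda>"
  shows "configs \<Lambda> N = occ ` {S. S \<subseteq> \<Lambda> \<and> card S = N}"
proof (intro equalityI subsetI)
  fix \<eta> assume \<eta>: "\<eta> \<in> configs \<Lambda> N"
  define S where "S = {x \<in> \<Lambda>. \<eta> x = 1}"
  have "\<eta> = occ S" using \<eta> by (fastforce simp: S_def occ_def configs_def)
  moreover have "card S = N"
  proof -
    have "N = (\<Sum>x\<in>\<Lambda>. if \<eta> x = 1 then 1 else 0)"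
      using \<eta> by (auto simp: configs_def intro!: sum.cong)
    also have "\<dots> = card S" using fin by (simp add: S_def sum.If_cases Int_def)
    finally show ?thesis by simp
  qed
  ultimately show "\<eta> \<in> occ ` {S. S \<subseteq> \<Lambda> \<and> card S = N}" by (auto simp: S_def)
next
  fix \<eta> assume "\<eta> \<in> occ ` {S. S \<subseteq> \<Lambda> \<and> card S = N}"
  then obtain S where S: "\<eta> = occ S" "S \<subseteq> \<Lambda>" "card S = N" by auto
  have "(\<Sum>x\<in>\<Lambda>. occ S x) = card (\<Lambda> \<inter> S)" using fin by (simp add: occ_def sum.If_cases)
  then show "\<eta> \<in> configs \<Lambda> N" using S by (auto simp: configs_def occ_def Int_absorb1)
qed

lemma weight_occ:
  assumes "finite \<Lambda>" "S \<subseteq> \<Lambda>"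
  shows "weight \<alpha> \<Lambda> (occ S) = prod (\<lambda>x. exp (\<alpha> x)) S"
proof -
  have "(\<Sum>x\<in>\<Lambda>. \<alpha> x * real (occ S x)) = (\<Sum>x\<in>\<Lambda>. if x \<in> S then \<alpha> x else 0)"
    by (intro sum.cong) (auto simp: occ_def)
  also have "\<dots> = sum \<alpha> S" using assms by (simp add: sum.If_cases Int_absorb1)
  finally have "weight \<alpha> \<Lambda> (occ S) = exp (sum \<alpha> S)" by (simp add: weight_def)
  also have "\<dots> = prod (\<lambda>x. exp (\<alpha> x)) S"
    using assms finite_subset by (intro exp_sum) blast
  finally show ?thesis .
qed

lemma Exp_eq:
  assumes "finite \<Lambda>"
  shows "Exp \<alpha> \<Lambda> N f = (\<Sum>S\<in>{S. S \<subseteq> \<Lambda> \<and> card S = N}. prod (\<lambda>x. exp (\<alpha> x)) S * f (occ S))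
    / (\<Sum>S\<in>{S. S \<subseteq> \<Lambda> \<and> card S = N}. prod (\<lambda>x. exp (\<alpha> x)) S)"
proof -
  have "(\<Sum>\<eta>\<in>configs \<Lambda> N. weight \<alpha> \<Lambda> \<eta> * g \<eta>)
      = (\<Sum>S\<in>{S. S \<subseteq> \<Lambda> \<and> card S = N}. prod (\<lambda>x. exp (\<alpha> x)) S * g (occ S))" for g
    unfolding configs_eq[OF assms]
    by (subst sum.reindex) (auto intro!: sum.cong simp: weight_occ[OF assms] inj_on_subset[OF inj_occ])
  from this[of f] this[of "\<lambda>_. 1"] show ?thesis by (simp add: Exp_def)
qed

lemma swap_conf_occ:
  assumes "x \<notin> R" "y \<notin> R" "x \<noteq> y"
  shows "swap_conf x y (occ (insert x R)) = occ (insert y R)"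
  using assms by (auto simp: swap_conf_def occ_def)

text \<open>The cutoff in \<open>F\<close> makes all environments without
  \<open>Suc (card R) = N\<close> contribute nothing; in the others \<open>c\<close> cancels and the
  gradient remains. The factor \<open>M\<close> pays for the weight \<open>l x\<close> of the moving
  particle, absent from \<open>swap_energy\<close>.\<close>

lemma swap_energy_le_grad:
  fixes f :: "'d config \<Rightarrow> real" and l :: "'d site \<Rightarrow> real"
  assumes fin: "finite \<Lambda>" and M: "M \<ge> 1" and l: "\<And>z. 1 / M \<le> l z"
    and xy: "x \<in> \<Lambda>" "y \<in> \<Lambda>" "x \<noteq> y"
    and F: "\<And>S. S \<subseteq> \<Lambda> \<Longrightarrow> F S = (if card S = N then f (occ S) - c else 0)"
  shows "swap_energy \<Lambda> l F x y \<le> M * (\<Sum>S\<in>{S. S \<subseteq> \<Lambda> \<and> card S = N}. prod l S * (grad x y f (occ S))\<^sup>2)"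
proof -
  let ?X = "{S. S \<subseteq> \<Lambda> \<and> card S = N}" and ?Y = "{R \<in> Pow (\<Lambda> - {x, y}). Suc (card R) = N}"
  have lpos: "l z > 0" for z using l[of z] M by (smt (verit) zero_less_divide_1_iff)
  have R: "finite R" "x \<notin> R" "y \<notin> R" "insert x R \<subseteq> \<Lambda>" "insert y R \<subseteq> \<Lambda>" if "R \<subseteq> \<Lambda> - {x, y}" for R
    using that fin finite_subset xy by auto
  have "swap_energy \<Lambda> l F x y = (\<Sum>R\<in>?Y. prod l R * (F (insert x R) - F (insert y R))\<^sup>2)"
    unfolding swap_energy_def
  proof (rule sum.mono_neutral_right)
    show "\<forall>S\<in>Pow (\<Lambda> - {x, y}) - ?Y. prod l S * (F (insert x S) - F (insert y S))\<^sup>2 = 0"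
    proof
      fix S assume "S \<in> Pow (\<Lambda> - {x, y}) - ?Y"
      then have S: "S \<subseteq> \<Lambda> - {x, y}" "Suc (card S) \<noteq> N" by auto
      then have "card (insert x S) \<noteq> N" "card (insert y S) \<noteq> N"
        by (simp_all add: R(1-3)[OF S(1)])
      then have "F (insert x S) = 0" "F (insert y S) = 0"
        by (simp_all add: F[OF R(4)[OF S(1)]] F[OF R(5)[OF S(1)]])
      then show "prod l S * (F (insert x S) - F (insert y S))\<^sup>2 = 0" by simp
    qed
  qed (use fin in auto)
  also have "\<dots> \<le> (\<Sum>R\<in>?Y. M * (prod l (insert x R) * (grad x y f (occ (insert x R)))\<^sup>2))"
  proof (rule sum_mono)
    fix S assume S: "S \<in> ?Y"
    then have S': "S \<subseteq> \<Lambda> - {x, y}" "Suc (card S) = N" by auto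
    then have d: "F (insert x S) - F (insert y S) = - grad x y f (occ (insert x S))"
      using R(1-3)[OF S'(1)] xy
      by (simp add: F[OF R(4)[OF S'(1)]] F[OF R(5)[OF S'(1)]] grad_def swap_conf_occ)
    have "1 \<le> M * l x" using mult_left_mono[OF l[of x], of M] M by simp
    then have "prod l S \<le> M * l x * prod l S"
      using mult_right_mono[of 1 "M * l x" "prod l S"] by (simp add: prod_nonneg less_imp_le[OF lpos])
    then have "prod l S \<le> M * prod l (insert x S)" using R(1,2)[OF S'(1)] by (simp add: mult.assoc)
    then have "prod l S * (grad x y f (occ (insert x S)))\<^sup>2 \<le> M * prod l (insert x S) * (grad x y f (occ (insert x S)))\<^sup>2"
      by (rule mult_right_mono) simp
    then show "prod l S * (F (insert x S) - F (insert y S))\<^sup>2 \<le> M * (prod l (insert x S) * (grad x y f (occ (insert x S)))\<^sup>2)"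
      unfolding d by (simp add: mult.assoc)
  qed
  also have "\<dots> = M * (\<Sum>S\<in>insert x ` ?Y. prod l S * (grad x y f (occ S))\<^sup>2)"
  proof -
    have "inj_on (insert x) ?Y"
      by (rule inj_onI) (metis (no_types, lifting) R(2) insert_ident mem_Collect_eq Pow_iff)
    then show ?thesis by (simp add: sum.reindex sum_distrib_left)
  qed
  also have "\<dots> \<le> M * (\<Sum>S\<in>?X. prod l S * (grad x y f (occ S))\<^sup>2)"
  proof (intro mult_left_mono sum_mono2)
    show "insert x ` ?Y \<subseteq> ?X"
    proof
      fix S assume "S \<in> insert x ` ?Y"
      then obtain T where T: "S = insert x T" "T \<subseteq> \<Lambda> - {x, y}" "Suc (card T) = N" by auto
      then show "S \<in> ?X" using R(1,2,4)[OF T(2)] by auto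
    qed
  qed (use fin M in \<open>auto simp: prod_nonneg less_imp_le[OF lpos]\<close>)
  finally show ?thesis .
qed

section \<open>Combination of the mean-field gap with the path comparison\<close>

theorem theorem2:
  fixes K :: real
  assumes "K > 0"
  shows "\<exists>C::real. \<forall>(\<alpha>::'d::finite site \<Rightarrow> real) (a::'d site) (L::nat) (N::nat) (f::'d config \<Rightarrow> real).
           (\<forall>x. - K \<le> \<alpha> x \<and> \<alpha> x \<le> K) \<longrightarrow> N \<le> L ^ card (UNIV :: 'd set) \<longrightarrow>
           Var \<alpha> (cube a L) N f
             \<le> C * (real L)\<^sup>2 * Exp \<alpha> (cube a L) N
                   (\<lambda>\<eta>. \<Sum>(x, y)\<in>{(x, y). x \<in> cube a L \<and> y \<in> cube a L \<and> adjacent x y}.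
                            (grad x y f \<eta>)\<^sup>2)"
proof -
  define M where "M = exp K"
  have M: "M \<ge> 1" using assms by (simp add: M_def)
  show ?thesis
  proof (rule cube_swap_energy_comparison[OF M, where 'd = 'd])
    fix C1 assume C1: "C1 \<ge> 0"
      and cmp: "\<And>(a :: 'd site) L (l :: 'd site \<Rightarrow> real) f. (\<And>z. 1 / M \<le> l z) \<Longrightarrow> (\<And>z. l z \<le> M) \<Longrightarrow>
         (\<Sum>x\<in>cube a L. \<Sum>y\<in>cube a L. swap_energy (cube a L) l f x y)
         \<le> C1 * (real L)\<^sup>2 * real (card (cube a L)) *
            (\<Sum>(x, y)\<in>adjacent_pairs (cube a L). swap_energy (cube a L) l f x y)"
    have "Var \<alpha> (cube a L) N f \<le> (M ^ 3 / 2 * C1 * M) * (real L)\<^sup>2 * Exp \<alpha> (cube a L) N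
            (\<lambda>\<eta>. \<Sum>(x, y)\<in>adjacent_pairs (cube a L). (grad x y f \<eta>)\<^sup>2)"
      if \<alpha>: "\<forall>x. - K \<le> \<alpha> x \<and> \<alpha> x \<le> K" for \<alpha> a L N and f :: "'d config \<Rightarrow> real"
    proof -
      let ?\<Lambda> = "cube a L" and ?X = "{S. S \<subseteq> cube a L \<and> card S = N}"
      define l where "l x = exp (\<alpha> x)" for x
      have l: "1 / M \<le> l x" "l x \<le> M" "l x > 0" for x
        using \<alpha> by (auto simp: l_def M_def exp_minus[symmetric] inverse_eq_divide[symmetric])
      define W where "W = sum (prod l) ?X"
      have finX: "finite ?X" using finite_cube[of a L] by simp
      have W0: "W \<ge> 0" unfolding W_def by (intro sum_nonneg prod_nonneg less_imp_le[OF l(3)])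
      have E: "Exp \<alpha> ?\<Lambda> N g = (\<Sum>S\<in>?X. prod l S * g (occ S)) / W" for g
        unfolding W_def l_def by (rule Exp_eq[OF finite_cube])
      define c where "c = Exp \<alpha> ?\<Lambda> N f"
      \<comment> \<open>Centred, as the mean-field gap requires, and zero off \<open>N\<close>
        particles, so that sums over all environments see only the ensemble with fixed
        number.\<close>
      define F where "F S = (if card S = N then f (occ S) - c else 0)" for S
      define V where "V = (\<Sum>S\<in>?X. prod l S * (F S)\<^sup>2)"
      define G where "G = (\<Sum>S\<in>?X. prod l S * (\<Sum>(x, y)\<in>adjacent_pairs ?\<Lambda>. (grad x y f (occ S))\<^sup>2))"
      have Var: "Var \<alpha> ?\<Lambda> N f = V / W"
      proof -
        have "Var \<alpha> ?\<Lambda> N f = (\<Sum>S\<in>?X. prod l S * (f (occ S) - c)\<^sup>2) / W"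
          unfolding Var_def c_def[symmetric] by (rule E)
        also have "(\<Sum>S\<in>?X. prod l S * (f (occ S) - c)\<^sup>2) = V"
          unfolding V_def by (intro sum.cong refl) (auto simp: F_def)
        finally show ?thesis .
      qed
      \<comment> \<open>\<open>c\<close> is a quotient by \<open>W\<close>, so \<open>W = 0\<close>
        is treated apart; all weights in the sum vanish then.\<close>
      have cW: "(\<Sum>S\<in>?X. prod l S * f (occ S)) = c * W"
      proof (cases "W = 0")
        case True
        moreover have "\<forall>S\<in>?X. 0 \<le> prod l S" by (simp add: prod_nonneg less_imp_le[OF l(3)])
        ultimately have "\<forall>S\<in>?X. prod l S = 0"
          unfolding W_def using sum_nonneg_eq_0_iff[OF finX, of "prod l"] by blast
        then show ?thesis using True by simp
      qed (simp add: c_def E)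
      have mean: "(\<Sum>S\<in>?X. prod l S * F S) = 0"
      proof -
        have "(\<Sum>S\<in>?X. prod l S * F S) = (\<Sum>S\<in>?X. prod l S * f (occ S) - prod l S * c)"
          by (intro sum.cong refl) (auto simp: F_def algebra_simps)
        then show ?thesis using cW by (simp add: sum_subtractf W_def sum_distrib_left mult.commute)
      qed
      have "V \<le> (M ^ 3 / 2 * C1 * M) * (real L)\<^sup>2 * G"
      proof (cases "card ?\<Lambda> = 0")
        \<comment> \<open>Cancelling the volume needs a nonempty cube. For the empty one only the
          empty set can occur, and there the zero mean forces \<open>F\<close> to vanish.\<close>
        case True
        then have "?\<Lambda> = {}" using finite_cube[of a L] by simp
        then have X: "?X = (if N = 0 then {{}} else {})" by auto
        then have "V = 0" using mean by (auto simp: V_def split: if_splits)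
        moreover have "G \<ge> 0" unfolding G_def
          by (intro sum_nonneg mult_nonneg_nonneg prod_nonneg less_imp_le[OF l(3)]) auto
        ultimately show ?thesis using M C1 by simp
      next
        case False
        let ?n = "real (card ?\<Lambda>)"
        have q0: "swap_energy ?\<Lambda> l F x y \<ge> 0" for x y by (rule swap_energy_nonneg) (simp add: less_imp_le l)
        have "?n * V \<le> M ^ 3 / 2 * (\<Sum>x\<in>?\<Lambda>. \<Sum>y\<in>?\<Lambda> - {x}. \<Sum>R\<in>{R. R \<subseteq> ?\<Lambda> - {x, y} \<and> Suc (card R) = N}.
            prod l R * (F (insert y R) - F (insert x R))\<^sup>2)"
          unfolding V_def by (rule Bernoulli_Laplace_gap[OF finite_cube M l(1,2) mean])
        \<comment> \<open>Passing from environments with \<open>Suc (card R) = N\<close> to all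
          environments, and including \<open>y = x\<close>, adds only nonnegative terms.\<close>
        also have "\<dots> \<le> M ^ 3 / 2 * (\<Sum>x\<in>?\<Lambda>. \<Sum>y\<in>?\<Lambda>. swap_energy ?\<Lambda> l F x y)"
        proof (intro mult_left_mono sum_mono)
          fix x
          have "(\<Sum>y\<in>?\<Lambda> - {x}. \<Sum>R\<in>{R. R \<subseteq> ?\<Lambda> - {x, y} \<and> Suc (card R) = N}. prod l R * (F (insert y R) - F (insert x R))\<^sup>2)
            \<le> (\<Sum>y\<in>?\<Lambda> - {x}. swap_energy ?\<Lambda> l F x y)"
            unfolding swap_energy_def power2_commute[of "F (insert x _)"]
            by (intro sum_mono sum_mono2) (auto simp: finite_cube prod_nonneg less_imp_le l)
          also have "\<dots> \<le> (\<Sum>y\<in>?\<Lambda>. swap_energy ?\<Lambda> l F x y)"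
            by (rule sum_mono2) (auto simp: finite_cube q0)
          finally show "(\<Sum>y\<in>?\<Lambda> - {x}. \<Sum>R\<in>{R. R \<subseteq> ?\<Lambda> - {x, y} \<and> Suc (card R) = N}. prod l R * (F (insert y R) - F (insert x R))\<^sup>2)
            \<le> (\<Sum>y\<in>?\<Lambda>. swap_energy ?\<Lambda> l F x y)" .
        qed (use M in auto)
        also have "\<dots> \<le> M ^ 3 / 2 * (C1 * (real L)\<^sup>2 * ?n * (\<Sum>(x, y)\<in>adjacent_pairs ?\<Lambda>. swap_energy ?\<Lambda> l F x y))"
          using M by (intro mult_left_mono cmp l) auto
        also have "\<dots> \<le> M ^ 3 / 2 * (C1 * (real L)\<^sup>2 * ?n * (M * G))"
        proof -
          have "(\<Sum>(x, y)\<in>adjacent_pairs ?\<Lambda>. swap_energy ?\<Lambda> l F x y)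
              \<le> (\<Sum>(x, y)\<in>adjacent_pairs ?\<Lambda>. M * (\<Sum>S\<in>?X. prod l S * (grad x y f (occ S))\<^sup>2))"
          proof (rule sum_mono, clarify)
            fix x y :: "'d site" assume "x \<in> ?\<Lambda>" "y \<in> ?\<Lambda>" "adjacent x y"
            moreover from this have "x \<noteq> y" by (auto simp: adjacent_def)
            ultimately show "swap_energy ?\<Lambda> l F x y \<le> M * (\<Sum>S\<in>?X. prod l S * (grad x y f (occ S))\<^sup>2)"
              by (intro swap_energy_le_grad[OF finite_cube M l(1)]) (auto simp: F_def)
          qed
          also have "\<dots> = M * G"
            unfolding G_def sum_distrib_left case_prod_unfold by (subst sum.swap) (rule refl)
          finally show ?thesis using M C1 by (intro mult_left_mono) auto
        qed
        \<comment> \<open>The volume from the gap meets the volume from the path comparison; after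
          cancellation \<open>L ^ 2\<close> is left.\<close>
        finally have "?n * V \<le> ?n * ((M ^ 3 / 2 * C1 * M) * (real L)\<^sup>2 * G)" by (simp add: mult_ac)
        then show ?thesis using False by (simp add: mult_le_cancel_left)
      qed
      then have "V / W \<le> (M ^ 3 / 2 * C1 * M) * (real L)\<^sup>2 * G / W" by (rule divide_right_mono[OF _ W0])
      then show ?thesis unfolding Var E G_def by simp
    qed
    then show ?thesis by blast
  qed
qed

end
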